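(* Nondegenerate symmetric sets, up to isomorphism, are in one-to-one correspondence with bijective cocycle quadruples, up to isomorphism. This correspondence is given by $F(X,S)=(G_X,X,\rho,\pi)$, where $\rho$ is the left action of the structure group $G_X$ on $X$ given by $x\mapsto f_x^{-1}$, and $\pi:G_X\to\mathbb{Z}^X$ is the canonical bijective 1-cocycle of $G_X$.
   Context: Nondegenerate symmetric sets. Let $X$ be a nonempty set and $S:X\times X\to X\times X$ a bijection, $S(x,y)=(g_x(y),f_y(x))$. $(X,S)$ is nondegenerate if all maps $f_y,g_x:X\to X$ are bijections; braided if $S^{12}S^{23}S^{12}=S^{23}S^{12}S^{23}$ on $X^3$; involutive if $S^2=\mathrm{id}$; symmetric if braided and involutive. $(X,S)$ and $(X',S')$ are isomorphic if there is a bijection $X\to X'$ carrying $S$ to $S'$. Structure group and canonical cocycle. $G_X$ is the group generated by the elements of $X$ with defining relations $xy=tz$ whenever $S(x,y)=(t,z)$. $\mathbb{Z}^X$ is the free abelian group on $X$ with generators $t_x$; $\mathrm{Aut}(X)\ltimes\mathbb{Z}^X$ is the semidirect product with $s\,t_x=t_{s(x)}\,s$. For a nondegenerate symmetric set, $x\mapsto f_x^{-1}$ extends to a left action $\rho$ of $G_X$ on $X$, and $x\mapsto f_x^{-1}t_x$ extends to a homomorphism $\phi:G_X\to\mathrm{Aut}(X)\ltimes\mathbb{Z}^X$. The canonical 1-cocycle $\pi:G_X\to\mathbb{Z}^X$ is defined by $\pi(g)=t$ if $\phi(g)=st$ with $s\in\mathrm{Aut}(X)$, $t\in\mathbb{Z}^X$;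 it is bijective. Bijective cocycle quadruples. A bijective cocycle quadruple is $(G,X,\rho,\pi)$, where $G$ is a group, $X$ a (nonempty) set, $\rho:G\times X\to X$ a left action of $G$ on $X$, and $\pi:G\to\mathbb{Z}^X$ a bijective 1-cocycle of $G$ with coefficients in $\mathbb{Z}^X$, where $G$ acts on $\mathbb{Z}^X$ via $\rho$; the 1-cocycle condition is $\pi(g_1g_2)=g_2^{-1}\pi(g_1)+\pi(g_2)$. An isomorphism $(G_1,X_1,\rho_1,\pi_1)\to(G_2,X_2,\rho_2,\pi_2)$ is a pair consisting of a bijection $f:X_1\to X_2$ and a group isomorphism $\varphi:G_1\to G_2$ such that $\rho_2(\varphi(g))\circ f=f\circ\rho_1(g)$ and $\pi_2(\varphi(g))=f(\pi_1(g))$ for all $g\in G_1$, where $f$ is extended to a homomorphism $\mathbb{Z}^{X_1}\to\mathbb{Z}^{X_2}$. *)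

theory Defs
  imports "HOL-Algebra.Group_Action" "HOL-Algebra.Free_Abelian_Groups"
begin

section \<open>Groups given by generators and relations\<close>

text \<open>A letter \<open>(x, True)\<close> stands for the generator \<open>x\<close>, and \<open>(x, False)\<close> for its inverse.\<close>

type_synonym 'a group_word = "('a \<times> bool) list"

definition words :: "'a set \<Rightarrow> 'a group_word set"
  where "words X = lists (X \<times> UNIV)"

inductive word_eq :: "'a set \<Rightarrow> ('a group_word \<times> 'a group_word) set \<Rightarrow>
    'a group_word \<Rightarrow> 'a group_word \<Rightarrow> bool" for X R
where
  refl: "w \<in> words X \<Longrightarrow> word_eq X R w w"
| sym: "word_eq X R u v \<Longrightarrow> word_eq X R v u"
| trans: "word_eq X R u v \<Longrightarrow> word_eq X R v w \<Longrightarrow> word_eq X R u w"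
| append: "word_eq X R u v \<Longrightarrow> word_eq X R u' v' \<Longrightarrow> word_eq X R (u @ u') (v @ v')"
| cancel: "x \<in> X \<Longrightarrow> word_eq X R [(x, b), (x, \<not> b)] []"
| relator: "(u, v) \<in> R \<Longrightarrow> u \<in> words X \<Longrightarrow> v \<in> words X \<Longrightarrow> word_eq X R u v"

definition word_class :: "'a set \<Rightarrow> ('a group_word \<times> 'a group_word) set \<Rightarrow>
    'a group_word \<Rightarrow> 'a group_word set"
  where "word_class X R w = {v. word_eq X R w v}"

definition presented_group :: "'a set \<Rightarrow> ('a group_word \<times> 'a group_word) set \<Rightarrow>
    'a group_word set monoid"
  where "presented_group X R =
    \<lparr>carrier = word_class X R ` words X,
     mult = (\<lambda>A B. \<Union>u\<in>A. \<Union>v\<in>B. word_class X R (u @ v)),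
     one = word_class X R []\<rparr>"

primrec eval_word :: "('g, 'm) monoid_scheme \<Rightarrow> ('a \<Rightarrow> 'g) \<Rightarrow> 'a group_word \<Rightarrow> 'g"
where
  "eval_word H h [] = \<one>\<^bsub>H\<^esub>"
| "eval_word H h (l # w) =
     (if snd l then h (fst l) else inv\<^bsub>H\<^esub> (h (fst l))) \<otimes>\<^bsub>H\<^esub> eval_word H h w"

text \<open>The homomorphism out of a presented group that extends a map \<open>h\<close> on generators.
  It is meaningful only when \<open>h\<close> respects the relations; see the lemmas \<open>extend_hom_hom\<close>,
  \<open>extend_hom_generator\<close> and \<open>extend_hom_unique\<close> below.\<close>

definition extend_hom :: "('g, 'm) monoid_scheme \<Rightarrow> ('a \<Rightarrow> 'g) \<Rightarrow> 'a group_word set \<Rightarrow> 'g"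
  where "extend_hom H h A = the_elem (eval_word H h ` A)"

lemma word_eq_words: "word_eq X R u v \<Longrightarrow> u \<in> words X \<and> v \<in> words X"
  by (induction rule: word_eq.induct) (auto simp: words_def)

lemma word_class_eq_iff:
  assumes "u \<in> words X" shows "word_class X R u = word_class X R v \<longleftrightarrow> word_eq X R u v"
proof
  assume e: "word_class X R u = word_class X R v"
  have "u \<in> word_class X R u"
    using assms by (simp add: word_class_def word_eq.refl)
  with e have "u \<in> word_class X R v" by simp
  then show "word_eq X R u v" by (auto simp: word_class_def intro: word_eq.sym)
next
  assume "word_eq X R u v"
  then show "word_class X R u = word_class X R v"
    unfolding word_class_def by (blast dest: word_eq.trans word_eq.sym)
qed

lemma mult_word_class:
  assumes "u \<in> words X" "v \<in> words X"
  shows "word_class X R u \<otimes>\<^bsub>presented_group X R\<^esub> word_class X R v = word_class X R (u @ v)"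
proof -
  have *: "word_class X R (u' @ v') = word_class X R (u @ v)"
    if "word_eq X R u u'" "word_eq X R v v'" for u' v'
    using word_eq.append[OF that] word_eq_words[OF word_eq.append[OF that]]
    by (metis word_class_eq_iff)
  have r: "u \<in> word_class X R u" "v \<in> word_class X R v"
    using assms by (simp_all add: word_class_def word_eq.refl)
  have "word_class X R u \<otimes>\<^bsub>presented_group X R\<^esub> word_class X R v
      = (\<Union>u'\<in>word_class X R u. \<Union>v'\<in>word_class X R v. word_class X R (u' @ v'))"
    by (simp add: presented_group_def)
  also have "\<dots> = (\<Union>u'\<in>word_class X R u. \<Union>v'\<in>word_class X R v. word_class X R (u @ v))"
    by (intro SUP_cong refl *) (simp_all add: word_class_def)
  also have "\<dots> = word_class X R (u @ v)" using r by blast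
  finally show ?thesis .
qed

lemma words_append [simp]: "u @ v \<in> words X \<longleftrightarrow> u \<in> words X \<and> v \<in> words X"
  by (auto simp: words_def)

lemma words_Nil [simp]: "[] \<in> words X" by (simp add: words_def)

lemma words_Cons [simp]: "l # w \<in> words X \<longleftrightarrow> fst l \<in> X \<and> w \<in> words X"
  by (cases l) (auto simp: words_def)

lemma word_left_inverse:
  assumes "w \<in> words X"
  shows "\<exists>v\<in>words X. word_eq X R (v @ w) []"
  using assms
proof (induction w)
  case Nil
  then show ?case by (intro bexI[of _ "[]"]) (auto intro: word_eq.refl)
next
  case (Cons l w)
  then obtain v where v: "v \<in> words X" "word_eq X R (v @ w) []" by auto
  obtain x b where l: "l = (x, b)" by fastforce
  have x: "x \<in> X" using Cons.prems l by simp
  have "word_eq X R [(x, \<not> b), (x, b)] []" using word_eq.cancel[OF x, of R "\<not> b"] by simp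
  then have "word_eq X R (v @ ([(x, \<not> b), (x, b)] @ w)) (v @ ([] @ w))"
    using v Cons.prems by (intro word_eq.append word_eq.refl) auto
  then have "word_eq X R ((v @ [(x, \<not> b)]) @ (l # w)) []"
    using word_eq.trans[OF _ v(2)] l by simp
  then show ?case using v x by (intro bexI[of _ "v @ [(x, \<not> b)]"]) auto
qed

lemma group_presented_group: "group (presented_group X R)"
proof (rule groupI)
  let ?G = "presented_group X R"
  have c: "carrier ?G = word_class X R ` words X" by (simp add: presented_group_def)
  have o: "\<one>\<^bsub>?G\<^esub> = word_class X R []" by (simp add: presented_group_def)
  show "x \<otimes>\<^bsub>?G\<^esub> y \<in> carrier ?G" if "x \<in> carrier ?G" "y \<in> carrier ?G" for x y
    using that by (auto simp: c mult_word_class)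
  show "\<one>\<^bsub>?G\<^esub> \<in> carrier ?G" by (auto simp: c o)
  show "x \<otimes>\<^bsub>?G\<^esub> y \<otimes>\<^bsub>?G\<^esub> z = x \<otimes>\<^bsub>?G\<^esub> (y \<otimes>\<^bsub>?G\<^esub> z)"
    if "x \<in> carrier ?G" "y \<in> carrier ?G" "z \<in> carrier ?G" for x y z
    using that by (auto simp: c mult_word_class)
  show "\<one>\<^bsub>?G\<^esub> \<otimes>\<^bsub>?G\<^esub> x = x" if "x \<in> carrier ?G" for x
    using that by (auto simp: c o mult_word_class)
  show "\<exists>y\<in>carrier ?G. y \<otimes>\<^bsub>?G\<^esub> x = \<one>\<^bsub>?G\<^esub>" if "x \<in> carrier ?G" for x
  proof -
    from that obtain w where w: "w \<in> words X" "x = word_class X R w" by (auto simp: c)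
    obtain v where v: "v \<in> words X" "word_eq X R (v @ w) []" using word_left_inverse[OF w(1)] by blast
    then show ?thesis using w
      by (intro bexI[of _ "word_class X R v"]) (auto simp: c o mult_word_class word_class_eq_iff)
  qed
qed

context
  fixes X :: "'a set" and R :: "('a group_word \<times> 'a group_word) set"
    and H :: "('g, 'm) monoid_scheme" and h :: "'a \<Rightarrow> 'g"
  assumes H: "group H" and h: "\<And>x. x \<in> X \<Longrightarrow> h x \<in> carrier H"
begin

interpretation group H by (fact H)

lemma eval_word_closed: "w \<in> words X \<Longrightarrow> eval_word H h w \<in> carrier H"
  by (induction w) (auto simp: h)

lemma eval_word_append:
  "u \<in> words X \<Longrightarrow> v \<in> words X \<Longrightarrow> eval_word H h (u @ v) = eval_word H h u \<otimes>\<^bsub>H\<^esub> eval_word H h v"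
  by (induction u) (auto simp: h eval_word_closed m_assoc)

context
  assumes rel: "\<And>u v. (u, v) \<in> R \<Longrightarrow> u \<in> words X \<Longrightarrow> v \<in> words X \<Longrightarrow> eval_word H h u = eval_word H h v"
begin

lemma eval_word_cong: "word_eq X R u v \<Longrightarrow> eval_word H h u = eval_word H h v"
proof (induction rule: word_eq.induct)
  case (append u v u' v')
  then show ?case using word_eq_words[of X R] by (metis eval_word_append)
qed (auto simp: rel h)

lemma extend_hom_word_class:
  assumes "w \<in> words X" shows "extend_hom H h (word_class X R w) = eval_word H h w"
proof -
  have "eval_word H h ` word_class X R w = {eval_word H h w}"
    using assms eval_word_cong by (force simp: word_class_def intro: word_eq.refl)
  then show ?thesis by (simp add: extend_hom_def)
qed

lemma extend_hom_hom: "extend_hom H h \<in> hom (presented_group X R) H"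
proof (rule homI)
  have c: "carrier (presented_group X R) = word_class X R ` words X" by (simp add: presented_group_def)
  show "extend_hom H h A \<in> carrier H" if "A \<in> carrier (presented_group X R)" for A
    using that by (auto simp: c extend_hom_word_class eval_word_closed)
  show "extend_hom H h (A \<otimes>\<^bsub>presented_group X R\<^esub> B) = extend_hom H h A \<otimes>\<^bsub>H\<^esub> extend_hom H h B"
    if "A \<in> carrier (presented_group X R)" "B \<in> carrier (presented_group X R)" for A B
    using that by (auto simp: c mult_word_class extend_hom_word_class eval_word_append)
qed

lemma extend_hom_generator:
  "x \<in> X \<Longrightarrow> extend_hom H h (word_class X R [(x, True)]) = h x"
  by (simp add: extend_hom_word_class h)

lemma extend_hom_unique:
  assumes k: "k \<in> hom (presented_group X R) H"
    and kx: "\<And>x. x \<in> X \<Longrightarrow> k (word_class X R [(x, True)]) = h x"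
    and A: "A \<in> carrier (presented_group X R)"
  shows "k A = extend_hom H h A"
proof -
  interpret k: group_hom "presented_group X R" H k
    using k H group_presented_group by (simp add: group_hom_def group_hom_axioms_def)
  have c: "carrier (presented_group X R) = word_class X R ` words X" by (simp add: presented_group_def)
  have o: "\<one>\<^bsub>presented_group X R\<^esub> = word_class X R []" by (simp add: presented_group_def)
  have letter: "k (word_class X R [(x, b)]) = (if b then h x else inv\<^bsub>H\<^esub> (h x))" if x: "x \<in> X" for x b
  proof (cases b)
    case False
    have "word_class X R [(x, False)] \<otimes>\<^bsub>presented_group X R\<^esub> word_class X R [(x, True)]
        = \<one>\<^bsub>presented_group X R\<^esub>"
      using x word_eq.cancel[OF x, of R False] by (simp add: mult_word_class o word_class_eq_iff)
    moreover have "word_class X R [(x, False)] \<in> carrier (presented_group X R)"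
      "word_class X R [(x, True)] \<in> carrier (presented_group X R)" using x by (auto simp: c)
    ultimately have "k (word_class X R [(x, False)]) \<otimes>\<^bsub>H\<^esub> h x = \<one>\<^bsub>H\<^esub>"
      "k (word_class X R [(x, False)]) \<in> carrier H"
      using kx[OF x] k.hom_mult k.hom_one by (metis, simp)
    then show ?thesis using False h[OF x] inv_equality by auto
  qed (use x kx in simp)
  have "k (word_class X R w) = eval_word H h w" if "w \<in> words X" for w
    using that
  proof (induction w)
    case Nil
    then show ?case using k.hom_one by (simp add: o)
  next
    case (Cons l w)
    then have "word_class X R (l # w) = word_class X R [l] \<otimes>\<^bsub>presented_group X R\<^esub> word_class X R w"
      by (simp add: mult_word_class)
    moreover have "word_class X R [l] \<in> carrier (presented_group X R)"
      "word_class X R w \<in> carrier (presented_group X R)" using Cons.prems by (auto simp: c)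
    ultimately have "k (word_class X R (l # w)) = k (word_class X R [l]) \<otimes>\<^bsub>H\<^esub> k (word_class X R w)"
      by simp
    then show ?case using Cons letter[of "fst l" "snd l"] by simp
  qed
  then show ?thesis using A by (auto simp: c extend_hom_word_class)
qed

end

end


section \<open>Nondegenerate symmetric sets\<close>

type_synonym 'a set_with_map = "'a set \<times> ('a \<times> 'a \<Rightarrow> 'a \<times> 'a)"

text \<open>Notation: \<open>S (x, y) = (g\<^sub>x y, f\<^sub>y x)\<close>.\<close>

definition g_map :: "('a \<times> 'a \<Rightarrow> 'a \<times> 'a) \<Rightarrow> 'a \<Rightarrow> 'a \<Rightarrow> 'a"
  where "g_map S x y = fst (S (x, y))"

definition f_map :: "('a \<times> 'a \<Rightarrow> 'a \<times> 'a) \<Rightarrow> 'a \<Rightarrow> 'a \<Rightarrow> 'a"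
  where "f_map S y x = snd (S (x, y))"

definition nondegenerate :: "'a set \<Rightarrow> ('a \<times> 'a \<Rightarrow> 'a \<times> 'a) \<Rightarrow> bool"
  where "nondegenerate X S \<longleftrightarrow>
    (\<forall>x\<in>X. bij_betw (g_map S x) X X \<and> bij_betw (f_map S x) X X)"

definition S12 :: "('a \<times> 'a \<Rightarrow> 'a \<times> 'a) \<Rightarrow> 'a \<times> 'a \<times> 'a \<Rightarrow> 'a \<times> 'a \<times> 'a"
  where "S12 S = (\<lambda>(x, y, z). case S (x, y) of (x', y') \<Rightarrow> (x', y', z))"

definition S23 :: "('a \<times> 'a \<Rightarrow> 'a \<times> 'a) \<Rightarrow> 'a \<times> 'a \<times> 'a \<Rightarrow> 'a \<times> 'a \<times> 'a"
  where "S23 S = (\<lambda>(x, y, z). case S (y, z) of (y', z') \<Rightarrow> (x, y', z'))"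

definition braided :: "'a set \<Rightarrow> ('a \<times> 'a \<Rightarrow> 'a \<times> 'a) \<Rightarrow> bool"
  where "braided X S \<longleftrightarrow>
    (\<forall>p \<in> X \<times> X \<times> X. S12 S (S23 S (S12 S p)) = S23 S (S12 S (S23 S p)))"

definition involutive :: "'a set \<Rightarrow> ('a \<times> 'a \<Rightarrow> 'a \<times> 'a) \<Rightarrow> bool"
  where "involutive X S \<longleftrightarrow> (\<forall>p \<in> X \<times> X. S (S p) = p)"

definition symmetric :: "'a set \<Rightarrow> ('a \<times> 'a \<Rightarrow> 'a \<times> 'a) \<Rightarrow> bool"
  where "symmetric X S \<longleftrightarrow> braided X S \<and> involutive X S"

definition nondegenerate_symmetric_sets :: "'a set_with_map set"
  where "nondegenerate_symmetric_sets =
    {(X, S). X \<noteq> {} \<and> bij_betw S (X \<times> X) (X \<times> X) \<and> nondegenerate X S \<and> symmetric X S}"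

definition set_isomorphic :: "'a set_with_map \<Rightarrow> 'b set_with_map \<Rightarrow> bool"
  where "set_isomorphic = (\<lambda>(X, S) (X', S').
    \<exists>f. bij_betw f X X' \<and>
      (\<forall>x\<in>X. \<forall>y\<in>X. S' (f x, f y) = map_prod f f (S (x, y))))"

definition set_iso_rel :: "('a set_with_map \<times> 'a set_with_map) set"
  where "set_iso_rel =
    {(P, P') \<in> nondegenerate_symmetric_sets \<times> nondegenerate_symmetric_sets. set_isomorphic P P'}"


section \<open>Bijective cocycle quadruples\<close>

text \<open>\<open>frag_map f\<close> is the extension of \<open>f\<close> to a homomorphism of free abelian groups.\<close>

definition frag_map :: "('a \<Rightarrow> 'b) \<Rightarrow> ('a \<Rightarrow>\<^sub>0 int) \<Rightarrow> ('b \<Rightarrow>\<^sub>0 int)"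
  where "frag_map f = frag_extend (\<lambda>x. frag_of (f x))"

type_synonym ('g, 'a) quadruple =
  "'g monoid \<times> 'a set \<times> ('g \<Rightarrow> 'a \<Rightarrow> 'a) \<times> ('g \<Rightarrow> ('a \<Rightarrow>\<^sub>0 int))"

definition bijective_cocycle_quadruples :: "('g, 'a) quadruple set"
  where "bijective_cocycle_quadruples =
    {(G, X, \<rho>, \<pi>). group G \<and> X \<noteq> {} \<and> group_action G X \<rho> \<and>
       bij_betw \<pi> (carrier G) (carrier (free_Abelian_group X)) \<and>
       (\<forall>a\<in>carrier G. \<forall>b\<in>carrier G.
          \<pi> (a \<otimes>\<^bsub>G\<^esub> b) = frag_map (\<rho> (inv\<^bsub>G\<^esub> b)) (\<pi> a) + \<pi> b)}"

definition quadruple_isomorphic :: "('g, 'a) quadruple \<Rightarrow> ('h, 'b) quadruple \<Rightarrow> bool"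
  where "quadruple_isomorphic = (\<lambda>(G\<^sub>1, X\<^sub>1, \<rho>\<^sub>1, \<pi>\<^sub>1) (G\<^sub>2, X\<^sub>2, \<rho>\<^sub>2, \<pi>\<^sub>2).
    \<exists>f \<phi>. bij_betw f X\<^sub>1 X\<^sub>2 \<and> \<phi> \<in> iso G\<^sub>1 G\<^sub>2 \<and>
      (\<forall>a\<in>carrier G\<^sub>1. (\<forall>x\<in>X\<^sub>1. \<rho>\<^sub>2 (\<phi> a) (f x) = f (\<rho>\<^sub>1 a x)) \<and>
                       \<pi>\<^sub>2 (\<phi> a) = frag_map f (\<pi>\<^sub>1 a)))"

definition quadruple_iso_rel :: "(('g, 'a) quadruple \<times> ('g, 'a) quadruple) set"
  where "quadruple_iso_rel =
    {(Q, Q') \<in> bijective_cocycle_quadruples \<times> bijective_cocycle_quadruples.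
       quadruple_isomorphic Q Q'}"


section \<open>The structure group and its canonical cocycle\<close>

definition structure_relations ::
    "'a set \<Rightarrow> ('a \<times> 'a \<Rightarrow> 'a \<times> 'a) \<Rightarrow> ('a group_word \<times> 'a group_word) set"
  where "structure_relations X S =
    {([(x, True), (y, True)], [(t, True), (z, True)]) | x y t z.
       x \<in> X \<and> y \<in> X \<and> S (x, y) = (t, z)}"

definition structure_group :: "'a set \<Rightarrow> ('a \<times> 'a \<Rightarrow> 'a \<times> 'a) \<Rightarrow> 'a group_word set monoid"
  where "structure_group X S = presented_group X (structure_relations X S)"

definition f_inv :: "'a set \<Rightarrow> ('a \<times> 'a \<Rightarrow> 'a \<times> 'a) \<Rightarrow> 'a \<Rightarrow> 'a \<Rightarrow> 'a"
  where "f_inv X S x = restrict (inv_into X (f_map S x)) X"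

definition structure_action ::
    "'a set \<Rightarrow> ('a \<times> 'a \<Rightarrow> 'a \<times> 'a) \<Rightarrow> 'a group_word set \<Rightarrow> 'a \<Rightarrow> 'a"
  where "structure_action X S = extend_hom (BijGroup X) (f_inv X S)"

text \<open>The semidirect product of \<open>Aut(X)\<close> and \<open>\<int>\<^sup>X\<close>, where \<open>(s, t)\<close> represents the product \<open>s t\<close>.
  As \<open>s t\<^sub>x = t\<^bsub>s(x)\<^esub> s\<close>, we have \<open>(s\<^sub>1 t\<^sub>1) (s\<^sub>2 t\<^sub>2) = s\<^sub>1 s\<^sub>2 (s\<^sub>2\<^sup>-\<^sup>1 \<cdot> t\<^sub>1) t\<^sub>2\<close>.\<close>

definition aut_semidirect :: "'a set \<Rightarrow> (('a \<Rightarrow> 'a) \<times> ('a \<Rightarrow>\<^sub>0 int)) monoid"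
  where "aut_semidirect X =
    \<lparr>carrier = carrier (BijGroup X) \<times> carrier (free_Abelian_group X),
     mult = (\<lambda>(s\<^sub>1, t\<^sub>1) (s\<^sub>2, t\<^sub>2).
       (s\<^sub>1 \<otimes>\<^bsub>BijGroup X\<^esub> s\<^sub>2, frag_map (inv\<^bsub>BijGroup X\<^esub> s\<^sub>2) t\<^sub>1 + t\<^sub>2)),
     one = (\<one>\<^bsub>BijGroup X\<^esub>, 0)\<rparr>"

definition structure_hom ::
    "'a set \<Rightarrow> ('a \<times> 'a \<Rightarrow> 'a \<times> 'a) \<Rightarrow> 'a group_word set \<Rightarrow> ('a \<Rightarrow> 'a) \<times> ('a \<Rightarrow>\<^sub>0 int)"
  where "structure_hom X S = extend_hom (aut_semidirect X) (\<lambda>x. (f_inv X S x, frag_of x))"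

definition canonical_cocycle ::
    "'a set \<Rightarrow> ('a \<times> 'a \<Rightarrow> 'a \<times> 'a) \<Rightarrow> 'a group_word set \<Rightarrow> ('a \<Rightarrow>\<^sub>0 int)"
  where "canonical_cocycle X S a = snd (structure_hom X S a)"

definition cocycle_quadruple :: "'a set_with_map \<Rightarrow> ('a group_word set, 'a) quadruple"
  where "cocycle_quadruple = (\<lambda>(X, S).
    (structure_group X S, X, structure_action X S, canonical_cocycle X S))"


subsection \<open>The action and the homomorphism extend the prescribed maps on generators\<close>

lemma frag_map_of [simp]: "frag_map f (frag_of x) = frag_of (f x)"
  by (simp add: frag_map_def)

lemma frag_map_0 [simp]: "frag_map f 0 = 0"
  by (simp add: frag_map_def)

lemma frag_map_add: "frag_map f (a + b) = frag_map f a + frag_map f b"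
  by (simp add: frag_map_def frag_extend_add)

lemma frag_map_cong:
  "Poly_Mapping.keys a \<subseteq> X \<Longrightarrow> (\<And>x. x \<in> X \<Longrightarrow> f x = g x) \<Longrightarrow> frag_map f a = frag_map g a"
  unfolding frag_map_def by (rule frag_extend_eq) auto

lemma frag_map_frag_map: "frag_map f (frag_map g a) = frag_map (f \<circ> g) a"
  using frag_extend_compose[of "\<lambda>x. frag_of (f x)" g a] by (simp add: frag_map_def o_def)

lemma frag_map_id: "Poly_Mapping.keys a \<subseteq> X \<Longrightarrow> (\<And>x. x \<in> X \<Longrightarrow> f x = x) \<Longrightarrow> frag_map f a = a"
  using frag_map_cong[of a X f "\<lambda>x. x"] frag_expansion[of a] by (simp add: frag_map_def)

lemma keys_frag_map: "Poly_Mapping.keys a \<subseteq> X \<Longrightarrow> f \<in> X \<rightarrow> Y \<Longrightarrow> Poly_Mapping.keys (frag_map f a) \<subseteq> Y"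
  using keys_frag_extend[of "\<lambda>x. frag_of (f x)" a] by (force simp: frag_map_def)

lemma BijGroup_mult_apply:
  "s \<in> carrier (BijGroup X) \<Longrightarrow> s' \<in> carrier (BijGroup X) \<Longrightarrow> x \<in> X \<Longrightarrow>
     (s \<otimes>\<^bsub>BijGroup X\<^esub> s') x = s (s' x)"
  by (simp add: BijGroup_def compose_def)

lemma BijGroup_funcset: "s \<in> carrier (BijGroup X) \<Longrightarrow> s \<in> X \<rightarrow> X"
  by (simp add: BijGroup_def Bij_imp_funcset)

lemma BijGroup_one_apply: "x \<in> X \<Longrightarrow> \<one>\<^bsub>BijGroup X\<^esub> x = x"
  by (simp add: BijGroup_def)

lemma group_aut_semidirect: "group (aut_semidirect X)"
proof -
  interpret B: group "BijGroup X" by (rule group_BijGroup)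
  let ?K = "{c :: 'a \<Rightarrow>\<^sub>0 int. Poly_Mapping.keys c \<subseteq> X}"
  have K: "carrier (free_Abelian_group X) = ?K" by (simp add: free_Abelian_group_def)
  have Kadd: "a + b \<in> ?K" if "a \<in> ?K" "b \<in> ?K" for a b
    using that keys_add[of a b] by auto
  have Kmap: "frag_map s a \<in> ?K" if "s \<in> carrier (BijGroup X)" "a \<in> ?K" for s a
    using keys_frag_map[of a X s X] that BijGroup_funcset by blast
  have comp: "frag_map s (frag_map s' a) = frag_map (s \<otimes>\<^bsub>BijGroup X\<^esub> s') a"
    if "s \<in> carrier (BijGroup X)" "s' \<in> carrier (BijGroup X)" "a \<in> ?K" for s s' a
    unfolding frag_map_frag_map
    by (rule frag_map_cong[where X = X]) (use that in \<open>auto simp: BijGroup_mult_apply\<close>)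
  have one: "frag_map \<one>\<^bsub>BijGroup X\<^esub> a = a" if "a \<in> ?K" for a
    by (rule frag_map_id[where X = X]) (use that in \<open>auto simp: BijGroup_one_apply\<close>)
  note mult_def = aut_semidirect_def
  show ?thesis
  proof (rule groupI)
    let ?G = "aut_semidirect X"
    show "p \<otimes>\<^bsub>?G\<^esub> q \<in> carrier ?G" if pq: "p \<in> carrier ?G" "q \<in> carrier ?G" for p q
    proof -
      obtain s t s' t' where e: "p = (s, t)" "q = (s', t')" "s \<in> carrier (BijGroup X)" "t \<in> ?K"
        "s' \<in> carrier (BijGroup X)" "t' \<in> ?K" using pq by (auto simp: mult_def K)
      have "frag_map (inv\<^bsub>BijGroup X\<^esub> s') t + t' \<in> ?K" using e by (intro Kadd Kmap B.inv_closed)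
      then show ?thesis using e by (simp add: mult_def K)
    qed
    show "\<one>\<^bsub>?G\<^esub> \<in> carrier ?G" by (simp add: mult_def K)
    show "p \<otimes>\<^bsub>?G\<^esub> q \<otimes>\<^bsub>?G\<^esub> r = p \<otimes>\<^bsub>?G\<^esub> (q \<otimes>\<^bsub>?G\<^esub> r)"
      if "p \<in> carrier ?G" "q \<in> carrier ?G" "r \<in> carrier ?G" for p q r
      using that
      by (auto simp: mult_def K frag_map_add B.m_assoc B.inv_mult_group add.assoc comp)
    show "\<one>\<^bsub>?G\<^esub> \<otimes>\<^bsub>?G\<^esub> p = p" if "p \<in> carrier ?G" for p
      using that by (auto simp: mult_def K)
    show "\<exists>q\<in>carrier ?G. q \<otimes>\<^bsub>?G\<^esub> p = \<one>\<^bsub>?G\<^esub>" if p: "p \<in> carrier ?G" for p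
    proof -
      obtain s t where st: "p = (s, t)" "s \<in> carrier (BijGroup X)" "t \<in> ?K"
        using p by (auto simp: mult_def K)
      have m: "- t \<in> ?K" using st by (simp add: keys_minus)
      have "frag_map (inv\<^bsub>BijGroup X\<^esub> s) (frag_map s (- t)) = - t"
        using comp[of "inv\<^bsub>BijGroup X\<^esub> s" s "- t"] one[OF m] st m by (simp add: keys_minus)
      then show ?thesis using st m Kmap[OF st(2) m]
        by (intro bexI[of _ "(inv\<^bsub>BijGroup X\<^esub> s, frag_map s (- t))"]) (auto simp: mult_def K)
    qed
  qed
qed

lemma aut_semidirect_relation:
  assumes s: "s \<in> carrier (BijGroup X)" and x: "x \<in> X"
  shows "(s, 0) \<otimes>\<^bsub>aut_semidirect X\<^esub> (\<one>\<^bsub>BijGroup X\<^esub>, frag_of x)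
       = (\<one>\<^bsub>BijGroup X\<^esub>, frag_of (s x)) \<otimes>\<^bsub>aut_semidirect X\<^esub> (s, 0)"
proof -
  interpret B: group "BijGroup X" by (rule group_BijGroup)
  have "(inv\<^bsub>BijGroup X\<^esub> s) (s x) = x"
    using BijGroup_mult_apply[of "inv\<^bsub>BijGroup X\<^esub> s" X s x] s x by (simp add: BijGroup_one_apply)
  then show ?thesis using s by (simp add: aut_semidirect_def)
qed

context
  fixes X :: "'a set" and S :: "'a \<times> 'a \<Rightarrow> 'a \<times> 'a"
  assumes XS: "(X, S) \<in> nondegenerate_symmetric_sets"
begin

lemma nss_f_bij: "x \<in> X \<Longrightarrow> bij_betw (f_map S x) X X"
  using XS by (simp add: nondegenerate_symmetric_sets_def nondegenerate_def)

lemma nss_f_closed: "x \<in> X \<Longrightarrow> y \<in> X \<Longrightarrow> f_map S x y \<in> X"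
  using nss_f_bij bij_betw_apply by metis

lemma nss_g_closed: "x \<in> X \<Longrightarrow> y \<in> X \<Longrightarrow> g_map S x y \<in> X"
  using XS bij_betw_apply[of "g_map S x" X X y]
  by (simp add: nondegenerate_symmetric_sets_def nondegenerate_def)

lemma nss_S: "S (x, y) = (g_map S x y, f_map S y x)"
  by (simp add: g_map_def f_map_def)

lemma nss_invol:
  assumes "x \<in> X" "y \<in> X" shows "f_map S (f_map S y x) (g_map S x y) = y"
proof -
  have "S (S (x, y)) = (x, y)"
    using XS assms by (auto simp: nondegenerate_symmetric_sets_def symmetric_def involutive_def)
  then show ?thesis by (simp add: nss_S)
qed

lemma nss_f_braid:
  assumes "x \<in> X" "y \<in> X" "u \<in> X"
  shows "f_map S y (f_map S x u) = f_map S (f_map S y x) (f_map S (g_map S x y) u)"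
proof -
  have "S12 S (S23 S (S12 S (u, x, y))) = S23 S (S12 S (S23 S (u, x, y)))"
    using XS assms by (auto simp: nondegenerate_symmetric_sets_def symmetric_def braided_def)
  then show ?thesis by (simp add: S12_def S23_def nss_S)
qed

lemma f_inv_closed: "x \<in> X \<Longrightarrow> f_inv X S x \<in> carrier (BijGroup X)"
  using nss_f_bij by (simp add: f_inv_def BijGroup_def Bij_def bij_betw_inv_into)

lemma f_f_inv: "x \<in> X \<Longrightarrow> u \<in> X \<Longrightarrow> f_map S x (f_inv X S x u) = u"
  using nss_f_bij[of x] by (simp add: f_inv_def bij_betw_inv_into_right)

lemma f_inv_f: "x \<in> X \<Longrightarrow> u \<in> X \<Longrightarrow> f_inv X S x (f_map S x u) = u"
  using nss_f_bij[of x] nss_f_closed[of x u] by (simp add: f_inv_def bij_betw_inv_into_left)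

lemma f_inv_in: "x \<in> X \<Longrightarrow> u \<in> X \<Longrightarrow> f_inv X S x u \<in> X"
  using BijGroup_funcset[OF f_inv_closed] by blast

lemma f_inv_relation:
  assumes "x \<in> X" "y \<in> X"
  shows "f_inv X S x \<otimes>\<^bsub>BijGroup X\<^esub> f_inv X S y
       = f_inv X S (g_map S x y) \<otimes>\<^bsub>BijGroup X\<^esub> f_inv X S (f_map S y x)"
proof -
  let ?t = "g_map S x y" and ?z = "f_map S y x"
  have tz: "?t \<in> X" "?z \<in> X" using assms nss_g_closed nss_f_closed by auto
  interpret B: group "BijGroup X" by (rule group_BijGroup)
  show ?thesis
  proof (rule extensionalityI[where A = X])
    show "f_inv X S x \<otimes>\<^bsub>BijGroup X\<^esub> f_inv X S y \<in> extensional X"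
      using f_inv_closed assms B.m_closed by (fastforce simp: BijGroup_def Bij_def)
    show "f_inv X S ?t \<otimes>\<^bsub>BijGroup X\<^esub> f_inv X S ?z \<in> extensional X"
      using f_inv_closed tz B.m_closed by (fastforce simp: BijGroup_def Bij_def)
    fix u assume u: "u \<in> X"
    define v where "v = f_inv X S x (f_inv X S y u)"
    have v: "v \<in> X" using u assms by (simp add: v_def f_inv_in)
    have "u = f_map S y (f_map S x v)" using u assms by (simp add: v_def f_inv_in f_f_inv)
    also have "\<dots> = f_map S ?z (f_map S ?t v)" using nss_f_braid assms v by simp
    finally have "f_inv X S ?t (f_inv X S ?z u) = v"
      using tz v by (simp add: f_inv_f nss_f_closed)
    then show "(f_inv X S x \<otimes>\<^bsub>BijGroup X\<^esub> f_inv X S y) u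
        = (f_inv X S ?t \<otimes>\<^bsub>BijGroup X\<^esub> f_inv X S ?z) u"
      using u assms tz by (simp add: BijGroup_mult_apply f_inv_closed v_def)
  qed
qed

lemma structure_action_relations:
  "(u, v) \<in> structure_relations X S \<Longrightarrow>
     eval_word (BijGroup X) (f_inv X S) u = eval_word (BijGroup X) (f_inv X S) v"
proof -
  interpret B: group "BijGroup X" by (rule group_BijGroup)
  assume "(u, v) \<in> structure_relations X S"
  then obtain x y where "x \<in> X" "y \<in> X" "u = [(x, True), (y, True)]"
    "v = [(g_map S x y, True), (f_map S y x, True)]"
    by (auto simp: structure_relations_def nss_S)
  then show ?thesis
    using f_inv_relation[of x y] by (simp add: f_inv_closed nss_g_closed nss_f_closed)
qed

lemma structure_hom_relations:
  assumes "(u, v) \<in> structure_relations X S"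
  shows "eval_word (aut_semidirect X) (\<lambda>x. (f_inv X S x, frag_of x)) u
       = eval_word (aut_semidirect X) (\<lambda>x. (f_inv X S x, frag_of x)) v"
proof -
  interpret B: group "BijGroup X" by (rule group_BijGroup)
  interpret A: group "aut_semidirect X" by (rule group_aut_semidirect)
  obtain x y where xy: "x \<in> X" "y \<in> X" "u = [(x, True), (y, True)]"
    "v = [(g_map S x y, True), (f_map S y x, True)]"
    using assms by (auto simp: structure_relations_def nss_S)
  let ?t = "g_map S x y" and ?z = "f_map S y x"
  have tz: "?t \<in> X" "?z \<in> X" using xy nss_g_closed nss_f_closed by auto
  have c: "(f_inv X S w, frag_of w) \<in> carrier (aut_semidirect X)" if "w \<in> X" for w
    using that f_inv_closed by (simp add: aut_semidirect_def free_Abelian_group_def)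
  have i: "(inv\<^bsub>BijGroup X\<^esub> (f_inv X S w)) w' = f_map S w w'" if "w \<in> X" "w' \<in> X" for w w'
  proof -
    have "(inv\<^bsub>BijGroup X\<^esub> (f_inv X S w)) (f_inv X S w (f_map S w w')) = f_map S w w'"
      using BijGroup_mult_apply[of "inv\<^bsub>BijGroup X\<^esub> (f_inv X S w)" X "f_inv X S w" "f_map S w w'"]
        that f_inv_closed nss_f_closed by (simp add: BijGroup_one_apply)
    then show ?thesis using that by (simp add: f_inv_f)
  qed
  have "(f_inv X S x, frag_of x) \<otimes>\<^bsub>aut_semidirect X\<^esub> (f_inv X S y, frag_of y)
      = (f_inv X S ?t, frag_of ?t) \<otimes>\<^bsub>aut_semidirect X\<^esub> (f_inv X S ?z, frag_of ?z)"
    using xy tz f_inv_relation[of x y] nss_invol[of x y]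
    by (simp add: aut_semidirect_def i add.commute)
  then show ?thesis using xy tz c by simp
qed

lemma structure_action_hom: "structure_action X S \<in> hom (structure_group X S) (BijGroup X)"
  unfolding structure_action_def structure_group_def
  by (intro extend_hom_hom group_BijGroup f_inv_closed structure_action_relations)

lemma structure_action_generator:
  "x \<in> X \<Longrightarrow> structure_action X S (word_class X (structure_relations X S) [(x, True)]) = f_inv X S x"
  unfolding structure_action_def
  by (intro extend_hom_generator[where X = X] group_BijGroup f_inv_closed structure_action_relations)

lemma structure_hom_hom: "structure_hom X S \<in> hom (structure_group X S) (aut_semidirect X)"
  unfolding structure_hom_def structure_group_def
  by (intro extend_hom_hom group_aut_semidirect structure_hom_relations)
    (simp_all add: aut_semidirect_def free_Abelian_group_def f_inv_closed)

lemma structure_hom_generator: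
  "x \<in> X \<Longrightarrow> structure_hom X S (word_class X (structure_relations X S) [(x, True)])
     = (f_inv X S x, frag_of x)"
  unfolding structure_hom_def
  by (rule extend_hom_generator[where X = X, OF group_aut_semidirect _ structure_hom_relations])
    (simp_all add: aut_semidirect_def free_Abelian_group_def f_inv_closed)

end

end

theory Submission
  imports Defs
begin

text \<open>
  Write \<open>e\<^sub>x\<close> for the basis element of \<open>\<int>\<^sup>X\<close> that belongs to \<open>x\<close>, and \<open>g\<cdot>y\<close> for an action. The
  cocycle condition gives \<open>\<pi>(xy) = e\<^sub>z + e\<^sub>y\<close> with \<open>z = f\<^sub>y(x)\<close>. If \<open>S(x, y) = (t, z)\<close>, involutivity
  says \<open>f\<^sub>z(t) = y\<close>, so that \<open>tz\<close> has the same cocycle value; the defining relations of the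
  structure group are the equalities of products that a bijective cocycle forces.

  Bijectivity of the canonical cocycle. On the set \<open>G\<^sub>X\<close> consider the maps
  \<open>\<tau>\<^sub>y(g) = (g\<cdot>y) g\<close>. They satisfy \<open>\<pi>(\<tau>\<^sub>y(g)) = \<pi>(g) + e\<^sub>y\<close>. They commute, because this amounts to the
  relation \<open>f\<^sub>x\<^sup>-\<^sup>1(u) x = f\<^sub>u\<^sup>-\<^sup>1(x) u\<close> in \<open>G\<^sub>X\<close>, and they are bijective, because \<open>x \<mapsto> f\<^sub>x\<^sup>-\<^sup>1(x)\<close> is a
  bijection of \<open>X\<close>. Hence \<open>e\<^sub>y \<mapsto> \<tau>\<^sub>y\<close> extends to an action of \<open>\<int>\<^sup>X\<close> on the set \<open>G\<^sub>X\<close>, and applying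
  \<open>u \<in> \<int>\<^sup>X\<close> to the unit element inverts \<open>\<pi>\<close>. No normal form for words is involved.

  Essential surjectivity. Given a quadruple, put \<open>\<iota>(x) = \<pi>\<^sup>-\<^sup>1(e\<^sub>x)\<close> and let \<open>f\<^sub>x\<close> be the action of
  \<open>\<iota>(x)\<^sup>-\<^sup>1\<close>. Involutivity forces \<open>S(x, y) = (f\<^sub>z\<^sup>-\<^sup>1(y), z)\<close> with \<open>z = f\<^sub>y(x)\<close>. Injectivity of \<open>\<pi>\<close> gives
  \<open>\<iota>(x) \<iota>(y) = \<iota>(t) \<iota>(z)\<close> for \<open>(t, z) = S(x, y)\<close>; bijectivity of the maps \<open>g\<^sub>x\<close> comes from comparing the
  cocycle values of the two sides of \<open>\<iota>(x)\<^sup>-\<^sup>1 \<iota>(t) = \<iota>(y) \<iota>(z)\<^sup>-\<^sup>1\<close>, and the braid relation from the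
  fact that \<open>(x, y, z) \<mapsto> (f\<^sub>z f\<^sub>y x, f\<^sub>z y, z)\<close> conjugates \<open>S\<^sup>1\<^sup>2\<close> and \<open>S\<^sup>2\<^sup>3\<close> to transpositions of
  coordinates.

  Isomorphisms. Since \<open>S\<close> is determined by the maps \<open>f\<^sub>x\<close>, an isomorphism of symmetric sets is the
  same as a bijection that intertwines the maps \<open>f\<^sub>x\<^sup>-\<^sup>1\<close>. Lemma \<open>quadruple_isomorphic_iff\<close>
  shows that the same bijections underlie the isomorphisms from \<open>F(X, S)\<close> to a given quadruple.
  This compares the two notions of isomorphism, and also identifies a quadruple with the one
  obtained from its reconstructed symmetric set.
\<close>


section \<open>Free abelian groups\<close>

lemma frag_map_minus: "frag_map f (- a) = - frag_map f a"
  by (simp add: frag_map_def frag_extend_minus)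

lemma bij_betw_frag_map:
  assumes "bij_betw f X Y"
  shows "bij_betw (frag_map f) (carrier (free_Abelian_group X)) (carrier (free_Abelian_group Y))"
proof (rule bij_betw_byWitness[where f' = "frag_map (inv_into X f)"])
  show "\<forall>a\<in>carrier (free_Abelian_group X). frag_map (inv_into X f) (frag_map f a) = a"
    by (auto simp: frag_map_frag_map bij_betw_inv_into_left[OF assms] intro!: frag_map_id[where X = X])
  show "\<forall>a\<in>carrier (free_Abelian_group Y). frag_map f (frag_map (inv_into X f) a) = a"
    by (auto simp: frag_map_frag_map bij_betw_inv_into_right[OF assms] intro!: frag_map_id[where X = Y])
  show "frag_map f ` carrier (free_Abelian_group X) \<subseteq> carrier (free_Abelian_group Y)"
    using keys_frag_map[of _ X f Y] bij_betw_imp_funcset[OF assms] by auto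
  show "frag_map (inv_into X f) ` carrier (free_Abelian_group Y) \<subseteq> carrier (free_Abelian_group X)"
    using keys_frag_map[of _ Y "inv_into X f" X] bij_betw_imp_funcset[OF bij_betw_inv_into[OF assms]]
    by auto
qed

text \<open>
  The universal property of free abelian groups needs a commutative target. The double centraliser
  of a commuting family is a commutative subgroup that contains the family: the family
  lies in its own centraliser \<open>C\<close>, so the centraliser \<open>Z\<close> of \<open>C\<close> is contained in \<open>C\<close>.
\<close>

lemma (in group) commuting_family_extends_to_free_Abelian_group:
  assumes t: "\<And>x. x \<in> X \<Longrightarrow> t x \<in> carrier G"
    and comm: "\<And>x y. x \<in> X \<Longrightarrow> y \<in> X \<Longrightarrow> t x \<otimes> t y = t y \<otimes> t x"
  obtains h where "h \<in> hom (free_Abelian_group X) G" "\<And>x. x \<in> X \<Longrightarrow> h (frag_of x) = t x"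
proof -
  define C where "C = {c \<in> carrier G. \<forall>x\<in>X. c \<otimes> t x = t x \<otimes> c}"
  define Z where "Z = {a \<in> carrier G. \<forall>c\<in>C. a \<otimes> c = c \<otimes> a}"
  have tC: "t x \<in> C" if "x \<in> X" for x using that t comm by (auto simp: C_def)
  have tZ: "t x \<in> Z" if "x \<in> X" for x using that t by (auto simp: Z_def C_def)
  have ZC: "Z \<subseteq> C" using tC by (auto simp: Z_def C_def)
  have C: "C \<subseteq> carrier G" by (auto simp: C_def)
  have sub: "subgroup Z G"
  proof (rule subgroupI)
    show "Z \<subseteq> carrier G" by (auto simp: Z_def)
    have "\<one> \<in> Z" using C by (auto simp: Z_def)
    then show "Z \<noteq> {}" by blast
    show "inv a \<in> Z" if "a \<in> Z" for a
    proof -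
      have a: "a \<in> carrier G" and ac: "a \<otimes> c = c \<otimes> a" if "c \<in> C" for c
        using \<open>a \<in> Z\<close> that by (auto simp: Z_def)
      have "inv a \<otimes> c = c \<otimes> inv a" if c: "c \<in> C" for c
      proof -
        have "c = inv a \<otimes> c \<otimes> a" using a[OF c] ac[OF c] c C by (auto simp: inv_solve_left m_assoc)
        then show ?thesis using a[OF c] c C by (metis inv_closed inv_solve_right' m_closed subsetD)
      qed
      then show ?thesis using \<open>a \<in> Z\<close> by (auto simp: Z_def)
    qed
    show "a \<otimes> b \<in> Z" if ab: "a \<in> Z" "b \<in> Z" for a b
    proof -
      have "a \<otimes> b \<otimes> c = c \<otimes> (a \<otimes> b)" if c: "c \<in> C" for c
      proof -
        have *: "a \<in> carrier G" "b \<in> carrier G" "c \<in> carrier G" "a \<otimes> c = c \<otimes> a" "b \<otimes> c = c \<otimes> b"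
          using ab c C by (auto simp: Z_def)
        have "a \<otimes> b \<otimes> c = a \<otimes> (c \<otimes> b)" using * by (simp add: m_assoc)
        also have "\<dots> = c \<otimes> a \<otimes> b" using * by (simp flip: m_assoc)
        finally show ?thesis using * by (simp add: m_assoc)
      qed
      then show ?thesis using ab by (auto simp: Z_def)
    qed
  qed
  have "comm_group (G\<lparr>carrier := Z\<rparr>)"
    by (rule group.group_comm_groupI[OF subgroup.subgroup_is_group[OF sub is_group]])
      (use ZC in \<open>auto simp: Z_def\<close>)
  then obtain h where h: "h \<in> hom (free_Abelian_group X) (G\<lparr>carrier := Z\<rparr>)"
    "\<And>x. x \<in> X \<Longrightarrow> h (frag_of x) = t x"
    using comm_group.free_Abelian_group_universal[of "G\<lparr>carrier := Z\<rparr>" t X] tZ by auto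
  have "h \<in> hom (free_Abelian_group X) G"
    using h(1) subgroup.subset[OF sub] by (auto simp: hom_def)
  then show ?thesis using h(2) that by blast
qed


section \<open>Cocycles with coefficients in a free abelian group\<close>

locale action_cocycle = group_action G X \<rho>
  for G :: "('g, 'm) monoid_scheme" (structure) and X :: "'a set" and \<rho> +
  fixes \<pi> :: "'g \<Rightarrow> ('a \<Rightarrow>\<^sub>0 int)"
  assumes cocycle_closed: "a \<in> carrier G \<Longrightarrow> Poly_Mapping.keys (\<pi> a) \<subseteq> X"
    and cocycle_mult: "a \<in> carrier G \<Longrightarrow> b \<in> carrier G \<Longrightarrow> \<pi> (a \<otimes> b) = frag_map (\<rho> (inv b)) (\<pi> a) + \<pi> b"

sublocale action_cocycle \<subseteq> group G
  using group_hom by (simp add: group_hom_def)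

context action_cocycle
begin

lemma action_one: "x \<in> X \<Longrightarrow> \<rho> \<one> x = x"
  using id_eq_one by (metis restrict_apply')

lemma action_closed: "a \<in> carrier G \<Longrightarrow> x \<in> X \<Longrightarrow> \<rho> a x \<in> X"
  using element_image by blast

lemma action_mult: "a \<in> carrier G \<Longrightarrow> b \<in> carrier G \<Longrightarrow> x \<in> X \<Longrightarrow> \<rho> (a \<otimes> b) x = \<rho> a (\<rho> b x)"
  using composition_rule by blast

lemma action_inv: "a \<in> carrier G \<Longrightarrow> x \<in> X \<Longrightarrow> \<rho> (inv a) (\<rho> a x) = x"
  by (simp add: action_one flip: action_mult)

lemma action_inv': "a \<in> carrier G \<Longrightarrow> x \<in> X \<Longrightarrow> \<rho> a (\<rho> (inv a) x) = x"
  by (simp add: action_one flip: action_mult)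

lemma action_bij: "a \<in> carrier G \<Longrightarrow> bij_betw (\<rho> a) X X"
  using bij_prop0 by (simp add: Bij_def)

lemma cocycle_one: "\<pi> \<one> = 0"
proof -
  have "\<pi> \<one> = frag_map (\<rho> \<one>) (\<pi> \<one>) + \<pi> \<one>" using cocycle_mult[of \<one> \<one>] by simp
  also have "frag_map (\<rho> \<one>) (\<pi> \<one>) = \<pi> \<one>"
    by (rule frag_map_id[OF cocycle_closed]) (simp_all add: action_one)
  finally show ?thesis by simp
qed

lemma cocycle_inv: "a \<in> carrier G \<Longrightarrow> \<pi> (inv a) = - frag_map (\<rho> a) (\<pi> a)"
  using cocycle_mult[of a "inv a"] by (simp add: cocycle_one eq_neg_iff_add_eq_0 add.commute)

lemma cocycle_mult_frag_of:
  "a \<in> carrier G \<Longrightarrow> b \<in> carrier G \<Longrightarrow> \<pi> a = frag_of x \<Longrightarrow> \<pi> (a \<otimes> b) = frag_of (\<rho> (inv b) x) + \<pi> b"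
  by (simp add: cocycle_mult)

end

locale bijective_cocycle = action_cocycle G X \<rho> \<pi>
  for G :: "('g, 'm) monoid_scheme" (structure) and X :: "'a set" and \<rho> \<pi> +
  assumes nonempty: "X \<noteq> {}"
    and cocycle_bij: "bij_betw \<pi> (carrier G) (carrier (free_Abelian_group X))"

lemma bijective_cocycle_iff:
  "(G, X, \<rho>, \<pi>) \<in> bijective_cocycle_quadruples \<longleftrightarrow> bijective_cocycle G X \<rho> \<pi>"
proof
  assume "(G, X, \<rho>, \<pi>) \<in> bijective_cocycle_quadruples"
  then have *: "group_action G X \<rho>" "X \<noteq> {}"
    "bij_betw \<pi> (carrier G) (carrier (free_Abelian_group X))"
    "\<forall>a\<in>carrier G. \<forall>b\<in>carrier G. \<pi> (a \<otimes>\<^bsub>G\<^esub> b) = frag_map (\<rho> (inv\<^bsub>G\<^esub> b)) (\<pi> a) + \<pi> b"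
    by (auto simp: bijective_cocycle_quadruples_def)
  then show "bijective_cocycle G X \<rho> \<pi>"
    using bij_betw_apply[OF *(3)]
    by (auto simp: bijective_cocycle_def bijective_cocycle_axioms_def action_cocycle_def
        action_cocycle_axioms_def)
next
  assume "bijective_cocycle G X \<rho> \<pi>"
  then interpret bijective_cocycle G X \<rho> \<pi> .
  show "(G, X, \<rho>, \<pi>) \<in> bijective_cocycle_quadruples"
    using nonempty cocycle_bij group_action_axioms is_group
    by (auto simp: bijective_cocycle_quadruples_def cocycle_mult)
qed

text \<open>
  For a bijective cocycle this is the element written \<open>\<iota>(x)\<close> in the introduction; in the structure
  group it is the generator \<open>x\<close> (lemma \<open>lift_eq_gen\<close>).
\<close>

definition basis_lift :: "('g, 'm) monoid_scheme \<Rightarrow> ('g \<Rightarrow> ('a \<Rightarrow>\<^sub>0 int)) \<Rightarrow> 'a \<Rightarrow> 'g"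
  where "basis_lift G \<pi> x = inv_into (carrier G) \<pi> (frag_of x)"

context bijective_cocycle
begin

abbreviation "lift \<equiv> basis_lift G \<pi>"

lemma lift [simp]:
  assumes "x \<in> X" shows "lift x \<in> carrier G" "\<pi> (lift x) = frag_of x"
proof -
  have "frag_of x \<in> \<pi> ` carrier G" using assms cocycle_bij by (simp add: bij_betw_def)
  then show "lift x \<in> carrier G" "\<pi> (lift x) = frag_of x"
    unfolding basis_lift_def by (rule inv_into_into, rule f_inv_into_f)
qed

lemma cocycle_inj: "a \<in> carrier G \<Longrightarrow> b \<in> carrier G \<Longrightarrow> \<pi> a = \<pi> b \<Longrightarrow> a = b"
  using cocycle_bij by (auto simp: bij_betw_def inj_on_def)

lemma cocycle_surj: "Poly_Mapping.keys u \<subseteq> X \<Longrightarrow> \<exists>a\<in>carrier G. \<pi> a = u"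
  using bij_betw_imp_surj_on[OF cocycle_bij] by (metis carrier_free_Abelian_group_iff imageE)

lemma lift_unique: "a \<in> carrier G \<Longrightarrow> x \<in> X \<Longrightarrow> \<pi> a = frag_of x \<Longrightarrow> a = lift x"
  using cocycle_inj lift by metis

end


section \<open>The canonical cocycle of a symmetric set is bijective\<close>

locale symmetric_set =
  fixes X :: "'a set" and S :: "'a \<times> 'a \<Rightarrow> 'a \<times> 'a"
  assumes nss: "(X, S) \<in> nondegenerate_symmetric_sets"
begin

abbreviation "G \<equiv> structure_group X S"
abbreviation "\<rho> \<equiv> structure_action X S"
abbreviation "\<pi> \<equiv> canonical_cocycle X S"
abbreviation "f_act \<equiv> f_inv X S"

definition gen :: "'a \<Rightarrow> 'a group_word set"
  where "gen x = word_class X (structure_relations X S) [(x, True)]"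

sublocale group G
  unfolding structure_group_def by (rule group_presented_group)

lemma carrier_G: "carrier G = word_class X (structure_relations X S) ` words X"
  by (simp add: structure_group_def presented_group_def)

lemma one_G: "\<one>\<^bsub>G\<^esub> = word_class X (structure_relations X S) []"
  by (simp add: structure_group_def presented_group_def)

lemma mult_G: "u \<in> words X \<Longrightarrow> v \<in> words X \<Longrightarrow>
    word_class X (structure_relations X S) u \<otimes>\<^bsub>G\<^esub> word_class X (structure_relations X S) v
    = word_class X (structure_relations X S) (u @ v)"
  by (simp add: structure_group_def mult_word_class)

lemma gen_closed [simp]: "x \<in> X \<Longrightarrow> gen x \<in> carrier G"
  by (auto simp: gen_def carrier_G)

text \<open>
  An equivalence in the induction step covers the letters \<open>x\<close> and \<open>x\<^sup>-\<^sup>1\<close> at once: its direction from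
  right to left prepends \<open>x\<close>, the other one prepends \<open>x\<^sup>-\<^sup>1\<close>.
\<close>

lemma structure_group_induct [consumes 1, case_names one step]:
  assumes a: "a \<in> carrier G" and one: "P \<one>\<^bsub>G\<^esub>"
    and step: "\<And>x b. x \<in> X \<Longrightarrow> b \<in> carrier G \<Longrightarrow> P (gen x \<otimes>\<^bsub>G\<^esub> b) \<longleftrightarrow> P b"
  shows "P a"
proof -
  have "P (word_class X (structure_relations X S) w)" if "w \<in> words X" for w
    using that
  proof (induction w)
    case Nil
    then show ?case using one by (simp add: one_G)
  next
    case (Cons l w)
    obtain x b where l: "l = (x, b)" by fastforce
    let ?c = "word_class X (structure_relations X S)"
    have x: "x \<in> X" "w \<in> words X" using Cons.prems l by auto
    show ?case
    proof (cases b)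
      case True
      have "?c (l # w) = gen x \<otimes>\<^bsub>G\<^esub> ?c w" using l x True by (simp add: gen_def mult_G)
      then show ?thesis using step[of x "?c w"] Cons.IH x by (auto simp: carrier_G)
    next
      case False
      have "word_eq X (structure_relations X S) ([(x, True), (x, False)] @ w) ([] @ w)"
        using word_eq.cancel[of x X _ True] x by (intro word_eq.append word_eq.refl) auto
      then have "gen x \<otimes>\<^bsub>G\<^esub> ?c (l # w) = ?c w"
        using l x False by (simp add: gen_def mult_G word_class_eq_iff)
      then show ?thesis using step[of x "?c (l # w)"] Cons.IH Cons.prems x by (auto simp: carrier_G)
    qed
  qed
  then show ?thesis using a by (auto simp: carrier_G)
qed

lemma action_gen: "x \<in> X \<Longrightarrow> \<rho> (gen x) = f_act x"
  unfolding gen_def by (rule structure_action_generator[OF nss])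

lemma cocycle_gen: "x \<in> X \<Longrightarrow> \<pi> (gen x) = frag_of x"
  unfolding gen_def canonical_cocycle_def by (simp add: structure_hom_generator[OF nss])

lemma fst_structure_hom: "a \<in> carrier G \<Longrightarrow> fst (structure_hom X S a) = \<rho> a"
proof -
  assume "a \<in> carrier G"
  moreover have "fst \<circ> structure_hom X S \<in> hom G (BijGroup X)"
  proof (rule Group.hom_compose[OF structure_hom_hom[OF nss]])
    show "fst \<in> hom (aut_semidirect X) (BijGroup X)"
      by (auto simp: hom_def aut_semidirect_def)
  qed
  ultimately show ?thesis
    unfolding structure_action_def structure_group_def
    using extend_hom_unique[OF group_BijGroup f_inv_closed[OF nss] structure_action_relations[OF nss],
        of X "structure_relations X S" "fst \<circ> structure_hom X S" a]
      structure_hom_generator[OF nss]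
    by simp
qed

sublocale coc: action_cocycle G X \<rho> \<pi>
proof -
  interpret A: group_hom G "BijGroup X" \<rho>
    using structure_action_hom[OF nss] group_BijGroup
    by (simp add: group_hom_def group_hom_axioms_def is_group)
  show "action_cocycle G X \<rho> \<pi>"
  proof
    fix a assume a: "a \<in> carrier G"
    then have "structure_hom X S a \<in> carrier (aut_semidirect X)"
      using structure_hom_hom[OF nss] by (auto simp: hom_def)
    then show "Poly_Mapping.keys (\<pi> a) \<subseteq> X"
      by (auto simp: canonical_cocycle_def aut_semidirect_def)
    fix b assume b: "b \<in> carrier G"
    have "structure_hom X S (a \<otimes>\<^bsub>G\<^esub> b)
        = structure_hom X S a \<otimes>\<^bsub>aut_semidirect X\<^esub> structure_hom X S b"
      using structure_hom_hom[OF nss] a b by (auto simp: hom_def)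
    then show "\<pi> (a \<otimes>\<^bsub>G\<^esub> b) = frag_map (\<rho> (inv\<^bsub>G\<^esub> b)) (\<pi> a) + \<pi> b"
      using fst_structure_hom[OF b] b
      by (simp add: canonical_cocycle_def aut_semidirect_def case_prod_beta)
  qed
qed

lemma g_map_conv: "x \<in> X \<Longrightarrow> y \<in> X \<Longrightarrow> g_map S x y = f_act (f_map S y x) y"
  using nss_invol[OF nss, of x y] f_inv_f[OF nss, of "f_map S y x" "g_map S x y"]
    nss_f_closed[OF nss] nss_g_closed[OF nss] by simp

text \<open>
  Applying \<open>S\<close> twice to \<open>(z, x)\<close> shows that if one coordinate of \<open>S(z, x)\<close> is the expected fixed
  point, then the injective map \<open>f\<^sub>x\<close> (or \<open>g\<^sub>z\<close>) takes the same value at the other coordinate as at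
  \<open>z\<close> (or \<open>x\<close>).
\<close>

lemma fixed_point_transfer:
  assumes "x \<in> X" "z \<in> X"
  shows "f_map S x z = x \<longleftrightarrow> g_map S z x = z"
proof -
  have SS: "S (S (z, x)) = (z, x)"
    using nss assms
    by (auto simp: nondegenerate_symmetric_sets_def symmetric_def involutive_def)
  have injs: "inj_on (f_map S x) X" "inj_on (g_map S z) X"
    using nss assms by (auto simp: nondegenerate_symmetric_sets_def nondegenerate_def bij_betw_def)
  have cl: "f_map S x z \<in> X" "g_map S z x \<in> X"
    using assms nss_f_closed[OF nss] nss_g_closed[OF nss] by auto
  show ?thesis
  proof
    assume "f_map S x z = x"
    then have "f_map S x (g_map S z x) = f_map S x z" using SS by (simp add: nss_S[OF nss])
    then show "g_map S z x = z" using injs cl assms by (auto dest: inj_onD)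
  next
    assume "g_map S z x = z"
    then have "g_map S z (f_map S x z) = g_map S z x" using SS by (simp add: nss_S[OF nss])
    then show "f_map S x z = x" using injs cl assms by (auto dest: inj_onD)
  qed
qed

text \<open>
  By \<open>fixed_point_transfer\<close> the equation \<open>f\<^sub>x\<^sup>-\<^sup>1(x) = z\<close> says \<open>g\<^sub>z(x) = z\<close>, so the inverse map is
  \<open>z \<mapsto> g\<^sub>z\<^sup>-\<^sup>1(z)\<close>.
\<close>

lemma diagonal_bij: "bij_betw (\<lambda>x. f_act x x) X X"
proof -
  have *: "f_act x x = z \<longleftrightarrow> g_map S z x = z" if "x \<in> X" "z \<in> X" for x z
    using fixed_point_transfer[OF that] f_f_inv[OF nss, of x x] f_inv_f[OF nss, of x z] that by auto
  have g: "bij_betw (g_map S z) X X" if "z \<in> X" for z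
    using nss that by (auto simp: nondegenerate_symmetric_sets_def nondegenerate_def)
  show ?thesis
  proof (rule bij_betwI')
    fix x x' assume x: "x \<in> X" "x' \<in> X"
    have c: "f_act x x \<in> X" using x f_inv_in[OF nss] by simp
    show "(f_act x x = f_act x' x') \<longleftrightarrow> x = x'"
    proof
      assume "f_act x x = f_act x' x'"
      then have "g_map S (f_act x x) x = g_map S (f_act x x) x'"
        using * x c by metis
      then show "x = x'" using g[OF c] x by (auto simp: bij_betw_def dest: inj_onD)
    qed simp
  next
    show "f_act x x \<in> X" if "x \<in> X" for x using that f_inv_in[OF nss] by simp
    show "\<exists>x\<in>X. z = f_act x x" if z: "z \<in> X" for z
    proof -
      obtain x where "x \<in> X" "g_map S z x = z" using bij_betw_imp_surj_on[OF g[OF z]] z by force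
      then show ?thesis using *[of x z] z by auto
    qed
  qed
qed

text \<open>
  This is the defining relation for the pair \<open>(f\<^sub>x\<^sup>-\<^sup>1(u), x)\<close>, whose image under \<open>S\<close> is
  \<open>(f\<^sub>u\<^sup>-\<^sup>1(x), u)\<close>. Its symmetry in \<open>x\<close> and \<open>u\<close> makes the translations below commute.
\<close>

lemma gen_relation:
  assumes "x \<in> X" "u \<in> X"
  shows "gen (f_act x u) \<otimes>\<^bsub>G\<^esub> gen x = gen (f_act u x) \<otimes>\<^bsub>G\<^esub> gen u"
proof -
  let ?v = "f_act x u"
  have v: "?v \<in> X" using assms f_inv_in[OF nss] by simp
  have fv: "f_map S x ?v = u" using assms f_f_inv[OF nss] by simp
  have "S (?v, x) = (f_act u x, u)"
    using g_map_conv[of ?v x] v assms fv by (simp add: nss_S[OF nss])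
  then have "([(?v, True), (x, True)], [(f_act u x, True), (u, True)]) \<in> structure_relations X S"
    using v assms by (auto simp: structure_relations_def)
  then have "word_eq X (structure_relations X S) [(?v, True), (x, True)] [(f_act u x, True), (u, True)]"
    using v assms f_inv_in[OF nss] by (intro word_eq.relator) auto
  then show ?thesis using v assms f_inv_in[OF nss] by (simp add: gen_def mult_G word_class_eq_iff)
qed

text \<open>
  Transported to \<open>\<int>\<^sup>X\<close> by the cocycle, this map becomes the translation by the basis element \<open>e\<^sub>y\<close>
  (lemma \<open>cocycle_translation\<close>). It is restricted to the carrier in order to be a member of \<open>BijGroup\<close>.
\<close>

definition translation :: "'a \<Rightarrow> 'a group_word set \<Rightarrow> 'a group_word set"
  where "translation y = (\<lambda>a\<in>carrier G. gen (\<rho> a y) \<otimes>\<^bsub>G\<^esub> a)"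

lemma translation_closed: "y \<in> X \<Longrightarrow> a \<in> carrier G \<Longrightarrow> translation y a \<in> carrier G"
  by (simp add: translation_def coc.action_closed)

lemma cocycle_translation:
  "y \<in> X \<Longrightarrow> a \<in> carrier G \<Longrightarrow> \<pi> (translation y a) = frag_of y + \<pi> a"
  using coc.cocycle_mult_frag_of[of "gen (\<rho> a y)" a "\<rho> a y"]
  by (simp add: translation_def coc.action_closed cocycle_gen coc.action_inv)

lemma translation_commute:
  assumes "y \<in> X" "z \<in> X" "a \<in> carrier G"
  shows "translation y (translation z a) = translation z (translation y a)"
proof -
  have *: "translation y (translation z a) = gen (f_act (\<rho> a z) (\<rho> a y)) \<otimes>\<^bsub>G\<^esub> gen (\<rho> a z) \<otimes>\<^bsub>G\<^esub> a"
    if "y \<in> X" "z \<in> X" for y z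
    using that assms f_inv_in[OF nss]
    by (simp add: translation_def coc.action_closed coc.action_mult action_gen m_assoc)
  show ?thesis
    using gen_relation[of "\<rho> a z" "\<rho> a y"] assms by (simp add: * coc.action_closed)
qed

text \<open>
  If \<open>b = x a\<close> with \<open>x = a\<cdot>y\<close>, then \<open>b\<cdot>y = f\<^sub>x\<^sup>-\<^sup>1(x)\<close>. By \<open>diagonal_bij\<close> this determines \<open>x\<close>, and then
  \<open>a = x\<^sup>-\<^sup>1 b\<close>, from \<open>b\<close>.
\<close>

lemma translation_bij:
  assumes y: "y \<in> X" shows "bij_betw (translation y) (carrier G) (carrier G)"
proof (rule bij_betwI')
  fix a b assume a: "a \<in> carrier G" and b: "b \<in> carrier G"
  have diag: "\<rho> (translation y c) y = f_act (\<rho> c y) (\<rho> c y)" if "c \<in> carrier G" for c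
    using that y by (simp add: translation_def coc.action_closed coc.action_mult action_gen)
  show "(translation y a = translation y b) \<longleftrightarrow> a = b"
  proof
    assume e: "translation y a = translation y b"
    then have "f_act (\<rho> a y) (\<rho> a y) = f_act (\<rho> b y) (\<rho> b y)" using diag a b by metis
    then have "\<rho> a y = \<rho> b y"
      using diagonal_bij a b y coc.action_closed by (auto simp: bij_betw_def dest: inj_onD)
    then show "a = b" using e a b y by (simp add: translation_def coc.action_closed)
  qed simp
next
  show "translation y a \<in> carrier G" if "a \<in> carrier G" for a
    using translation_closed[OF y that] .
  show "\<exists>a\<in>carrier G. b = translation y a" if b: "b \<in> carrier G" for b
  proof -
    have "\<rho> b y \<in> (\<lambda>x. f_act x x) ` X"
      using diagonal_bij coc.action_closed[OF b y] by (simp add: bij_betw_def)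
    then obtain x where x: "x \<in> X" "f_act x x = \<rho> b y" by force
    let ?a = "inv\<^bsub>G\<^esub> (gen x) \<otimes>\<^bsub>G\<^esub> b"
    have "\<rho> ?a y = \<rho> (inv\<^bsub>G\<^esub> (gen x)) (\<rho> (gen x) x)"
      using x b y by (simp add: coc.action_mult action_gen)
    also have "\<dots> = x" using x by (simp add: coc.action_inv)
    finally have "translation y ?a = b"
      using x b by (simp add: translation_def m_assoc[symmetric])
    then show ?thesis using x b by (intro bexI[of _ ?a]) auto
  qed
qed

text \<open>
  The inverse of the cocycle sends \<open>u\<close> to \<open>h(u)(1)\<close>, where \<open>h\<close> is the action of the free abelian
  group by translations.
\<close>

sublocale coc: bijective_cocycle G X \<rho> \<pi>
proof
  show "X \<noteq> {}" using nss by (simp add: nondegenerate_symmetric_sets_def)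
  interpret B: group "BijGroup (carrier G)" by (rule group_BijGroup)
  have B: "translation y \<in> carrier (BijGroup (carrier G))" if "y \<in> X" for y
    using translation_bij[OF that] by (simp add: BijGroup_def Bij_def translation_def)
  have comm: "translation y \<otimes>\<^bsub>BijGroup (carrier G)\<^esub> translation z
      = translation z \<otimes>\<^bsub>BijGroup (carrier G)\<^esub> translation y" if "y \<in> X" "z \<in> X" for y z
    using B[OF that(1)] B[OF that(2)] translation_commute[OF that]
    by (auto simp: BijGroup_def compose_def fun_eq_iff restrict_def)
  obtain h where h: "h \<in> hom (free_Abelian_group X) (BijGroup (carrier G))"
    and h_of: "\<And>y. y \<in> X \<Longrightarrow> h (frag_of y) = translation y"
    using B.commuting_family_extends_to_free_Abelian_group[of X translation] B comm by blast
  have h_perm: "h u \<in> carrier (BijGroup (carrier G))" if "Poly_Mapping.keys u \<subseteq> X" for u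
    using hom_in_carrier[OF h, of u] that by simp
  have h_add: "h (u + v) a = h u (h v a)"
    if "Poly_Mapping.keys u \<subseteq> X" "Poly_Mapping.keys v \<subseteq> X" "a \<in> carrier G" for u v a
    using hom_mult[OF h, of u v] that h_perm[of u] h_perm[of v]
    by (simp add: BijGroup_mult_apply)
  have h_closed: "h u a \<in> carrier G" if "Poly_Mapping.keys u \<subseteq> X" "a \<in> carrier G" for u a
    using BijGroup_funcset[OF h_perm[of u]] that by auto
  have h_zero: "h 0 \<one>\<^bsub>G\<^esub> = \<one>\<^bsub>G\<^esub>"
    using hom_one[OF h group_free_Abelian_group group_BijGroup] by (simp add: BijGroup_one_apply)
  (* The step of the induction: xb is the translate of b by the basis element of b^-1 x, and
     translations are injective, so h fixes the claim for xb exactly when it does for b. *)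
  have left: "h (\<pi> a) \<one>\<^bsub>G\<^esub> = a" if "a \<in> carrier G" for a
    using that
  proof (induction rule: structure_group_induct)
    case one
    show ?case by (simp add: coc.cocycle_one h_zero)
  next
    case (step x b)
    let ?y = "\<rho> (inv\<^bsub>G\<^esub> b) x"
    have y: "?y \<in> X" using step by (simp add: coc.action_closed)
    have t: "translation ?y b = gen x \<otimes>\<^bsub>G\<^esub> b"
      using step by (simp add: translation_def coc.action_inv')
    have "h (\<pi> (gen x \<otimes>\<^bsub>G\<^esub> b)) \<one>\<^bsub>G\<^esub> = translation ?y (h (\<pi> b) \<one>\<^bsub>G\<^esub>)"
      using step y coc.cocycle_mult_frag_of[of "gen x" b x]
      by (simp add: cocycle_gen h_add coc.cocycle_closed h_of)
    moreover have "translation ?y (h (\<pi> b) \<one>\<^bsub>G\<^esub>) = translation ?y b \<longleftrightarrow> h (\<pi> b) \<one>\<^bsub>G\<^esub> = b"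
      using step coc.cocycle_closed h_closed
      by (intro inj_on_eq_iff[OF bij_betw_imp_inj_on[OF translation_bij[OF y]]]) auto
    ultimately show ?case using t by simp
  qed
  have "\<forall>a\<in>carrier G. \<pi> (h u a) = u + \<pi> a" if "Poly_Mapping.keys u \<subseteq> X" for u
    using that
  proof (induction rule: free_Abelian_group_induct[consumes 1, case_names zero diff gen])
    case zero
    show ?case
      using hom_one[OF h group_free_Abelian_group group_BijGroup] by (simp add: BijGroup_one_apply)
  next
    case (diff u v)
    show ?case
    proof
      fix a assume a: "a \<in> carrier G"
      have mv: "Poly_Mapping.keys (- v) \<subseteq> X" using diff by (simp add: keys_minus)
      have "h 0 a = h v (h (- v) a)" using h_add[of v "- v" a] diff mv a by simp
      then have "h v (h (- v) a) = a"
        using hom_one[OF h group_free_Abelian_group group_BijGroup] a by (simp add: BijGroup_one_apply)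
      then have "\<pi> a = v + \<pi> (h (- v) a)" using diff h_closed[OF mv a] by metis
      moreover have "\<pi> (h (u - v) a) = u + \<pi> (h (- v) a)"
        using h_add[of u "- v" a] diff mv a h_closed[OF mv a] by simp
      ultimately show "\<pi> (h (u - v) a) = u - v + \<pi> a" by simp
    qed
  next
    case (gen y)
    then show ?case by (simp add: h_of cocycle_translation)
  qed
  then have right: "\<pi> (h u \<one>\<^bsub>G\<^esub>) = u" if "Poly_Mapping.keys u \<subseteq> X" for u
    using that by (simp add: coc.cocycle_one)
  show "bij_betw \<pi> (carrier G) (carrier (free_Abelian_group X))"
    by (rule bij_betw_byWitness[where f' = "\<lambda>u. h u \<one>\<^bsub>G\<^esub>"])
      (use left right coc.cocycle_closed h_closed in auto)
qed

lemma lift_eq_gen: "x \<in> X \<Longrightarrow> basis_lift G \<pi> x = gen x"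
  using coc.lift_unique[of "gen x" x] by (simp add: cocycle_gen)

end


section \<open>The symmetric set of a bijective cocycle\<close>

context bijective_cocycle
begin

text \<open>
  The second coordinate is \<open>f\<^sub>y(x)\<close> with \<open>f\<^sub>y\<close> the action of \<open>\<iota>(y)\<^sup>-\<^sup>1\<close>. The first coordinate \<open>t\<close> is
  then the only one that allows \<open>f\<^sub>z(t) = y\<close>, which involutivity demands.
\<close>

definition cocycle_map :: "'a \<times> 'a \<Rightarrow> 'a \<times> 'a"
  where "cocycle_map = (\<lambda>(x, y). let z = \<rho> (inv (lift y)) x in (\<rho> (lift z) y, z))"

lemma f_map_cocycle_map: "f_map cocycle_map y x = \<rho> (inv (lift y)) x"
  by (simp add: f_map_def cocycle_map_def Let_def)

lemma g_map_cocycle_map: "g_map cocycle_map x y = \<rho> (lift (\<rho> (inv (lift y)) x)) y"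
  by (simp add: g_map_def cocycle_map_def Let_def)

lemma cocycle_map_apply: "cocycle_map (x, y) = (g_map cocycle_map x y, f_map cocycle_map y x)"
  by (simp add: g_map_def f_map_def)

lemma f_map_cocycle_map_bij: "y \<in> X \<Longrightarrow> bij_betw (f_map cocycle_map y) X X"
  using action_bij[of "inv (lift y)"] by (simp add: f_map_cocycle_map[abs_def])

lemma f_map_cocycle_map_closed: "x \<in> X \<Longrightarrow> y \<in> X \<Longrightarrow> f_map cocycle_map y x \<in> X"
  by (simp add: f_map_cocycle_map action_closed)

lemma g_map_cocycle_map_closed: "x \<in> X \<Longrightarrow> y \<in> X \<Longrightarrow> g_map cocycle_map x y \<in> X"
  by (simp add: g_map_cocycle_map action_closed)

lemma f_map_g_map_cocycle_map:
  "x \<in> X \<Longrightarrow> y \<in> X \<Longrightarrow> f_map cocycle_map (f_map cocycle_map y x) (g_map cocycle_map x y) = y"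
  by (simp add: f_map_cocycle_map g_map_cocycle_map action_inv action_closed)

lemma g_map_cocycle_map_unique:
  "x \<in> X \<Longrightarrow> y \<in> X \<Longrightarrow> t \<in> X \<Longrightarrow> f_map cocycle_map (f_map cocycle_map y x) t = y \<Longrightarrow>
     g_map cocycle_map x y = t"
  using action_inv'[of "lift (\<rho> (inv (lift y)) x)" t]
  by (simp add: f_map_cocycle_map g_map_cocycle_map action_closed)

lemma cocycle_lift_mult:
  "x \<in> X \<Longrightarrow> y \<in> X \<Longrightarrow> \<pi> (lift x \<otimes> lift y) = frag_of (f_map cocycle_map y x) + frag_of y"
  by (simp add: f_map_cocycle_map cocycle_mult_frag_of)

text \<open>
  Both sides have cocycle value \<open>e\<^sub>y + e\<^sub>z\<close> for \<open>z = f\<^sub>y(x)\<close>, with the summands interchanged.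
\<close>

lemma lift_relation:
  assumes "x \<in> X" "y \<in> X"
  shows "lift x \<otimes> lift y = lift (g_map cocycle_map x y) \<otimes> lift (f_map cocycle_map y x)"
proof (rule cocycle_inj)
  show "\<pi> (lift x \<otimes> lift y) = \<pi> (lift (g_map cocycle_map x y) \<otimes> lift (f_map cocycle_map y x))"
    using assms f_map_g_map_cocycle_map[OF assms] f_map_cocycle_map_closed g_map_cocycle_map_closed
    by (simp add: cocycle_lift_mult add.commute)
qed (use assms f_map_cocycle_map_closed g_map_cocycle_map_closed in simp_all)

lemma involutive_cocycle_map: "involutive X cocycle_map"
  unfolding involutive_def
proof clarify
  fix x y assume xy: "x \<in> X" "y \<in> X"
  let ?z = "f_map cocycle_map y x" and ?t = "g_map cocycle_map x y"
  have tz: "?t \<in> X" "?z \<in> X"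
    using xy f_map_cocycle_map_closed g_map_cocycle_map_closed by blast+
  have f: "f_map cocycle_map ?z ?t = y" using f_map_g_map_cocycle_map[OF xy] .
  then have "g_map cocycle_map ?t ?z = x" using g_map_cocycle_map_unique[OF tz xy(1)] by metis
  with f show "cocycle_map (cocycle_map (x, y)) = (x, y)"
    by (simp add: cocycle_map_apply)
qed

lemma cocycle_inv_lift: "x \<in> X \<Longrightarrow> \<pi> (inv (lift x)) = - frag_of (\<rho> (lift x) x)"
  by (simp add: cocycle_inv)

text \<open>
  The basis element that belongs to the image of \<open>x\<close> is \<open>-\<pi>(\<iota>(x)\<^sup>-\<^sup>1)\<close>, so the image determines
  \<open>\<iota>(x)\<close> and hence \<open>x\<close>. For surjectivity at \<open>u\<close> take \<open>a\<close> with \<open>\<pi>(a) = -e\<^sub>u\<close>; then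
  \<open>a\<^sup>-\<^sup>1 = \<iota>(a\<cdot>u)\<close>, and \<open>a\<cdot>u\<close> is a preimage.
\<close>

lemma lift_diagonal_bij: "bij_betw (\<lambda>x. \<rho> (lift x) x) X X"
proof (rule bij_betwI')
  fix x x' assume x: "x \<in> X" "x' \<in> X"
  show "(\<rho> (lift x) x = \<rho> (lift x') x') \<longleftrightarrow> x = x'"
  proof
    assume "\<rho> (lift x) x = \<rho> (lift x') x'"
    then have "inv (lift x) = inv (lift x')"
      using x by (intro cocycle_inj) (simp_all add: cocycle_inv_lift)
    then have "lift x = lift x'" using x by (metis inv_inv lift(1))
    then have "frag_of x = frag_of x'" using x lift(2) by metis
    then show "x = x'" by (simp add: frag_of_eq)
  qed simp
next
  show "\<rho> (lift x) x \<in> X" if "x \<in> X" for x using that by (simp add: action_closed)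
  show "\<exists>x\<in>X. u = \<rho> (lift x) x" if u: "u \<in> X" for u
  proof -
    obtain a where a: "a \<in> carrier G" "\<pi> a = - frag_of u"
      using cocycle_surj[of "- frag_of u"] u by (auto simp: keys_minus)
    have "\<pi> (inv a) = frag_of (\<rho> a u)" using a by (simp add: cocycle_inv frag_map_minus)
    then have "inv a = lift (\<rho> a u)" using a u by (intro lift_unique) (simp_all add: action_closed)
    then have "\<rho> (lift (\<rho> a u)) (\<rho> a u) = u" using a u action_inv by metis
    then show ?thesis using action_closed[OF a(1) u] by metis
  qed
qed

lemma cocycle_lift_quotient:
  assumes "x \<in> X" "t \<in> X"
  shows "\<pi> (inv (lift x) \<otimes> lift t) = frag_of t - frag_of (\<rho> (inv (lift t)) (\<rho> (lift x) x))"
  using assms by (simp add: cocycle_mult cocycle_inv_lift frag_map_minus)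

text \<open>
  Let \<open>T\<close> be the bijection of \<open>lift_diagonal_bij\<close> and \<open>S(x, y) = (t, z)\<close>. The cocycle values of the two
  sides of \<open>\<iota>(x)\<^sup>-\<^sup>1 \<iota>(t) = \<iota>(y) \<iota>(z)\<^sup>-\<^sup>1\<close> are \<open>e\<^sub>t - e\<^sub>v\<close> for \<open>v = f\<^sub>t(T(x))\<close> and \<open>e\<^sub>t - e\<^sub>w\<close> for
  \<open>w = T(z)\<close>. So \<open>T(z) = f\<^sub>t(T(x))\<close>: \<open>x\<close> and \<open>t\<close> determine \<open>z\<close>, hence also \<open>y = f\<^sub>z(t)\<close>.
  Conversely, solving this equation for \<open>z\<close> produces a preimage \<open>y\<close> of any \<open>t\<close>.
\<close>

lemma g_map_cocycle_map_bij:
  assumes x: "x \<in> X" shows "bij_betw (g_map cocycle_map x) X X"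
proof (rule bij_betwI')
  let ?T = "\<lambda>x. \<rho> (lift x) x"
  have T: "?T z = \<rho> (inv (lift (g_map cocycle_map x y))) (?T x)"
    if "y \<in> X" and z: "z = f_map cocycle_map y x" for y z
  proof -
    let ?t = "g_map cocycle_map x y"
    have c: "z \<in> X" "?t \<in> X" "f_map cocycle_map z ?t = y"
      using x that f_map_cocycle_map_closed g_map_cocycle_map_closed f_map_g_map_cocycle_map
      by simp_all
    have "\<rho> (lift z) y = ?t" using x that by (simp add: f_map_cocycle_map g_map_cocycle_map)
    then have "\<pi> (lift y \<otimes> inv (lift z)) = frag_of ?t - frag_of (?T z)"
      using that c by (simp add: cocycle_mult cocycle_inv_lift)
    moreover have "inv (lift x) \<otimes> lift ?t = lift y \<otimes> inv (lift z)"
    proof -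
      have "lift x \<otimes> lift y = lift ?t \<otimes> lift z" using lift_relation[OF x that(1)] z by simp
      then have "lift ?t = lift x \<otimes> lift y \<otimes> inv (lift z)"
        using x that(1) c by (simp add: inv_solve_right)
      then show ?thesis using x that(1) c by (simp add: m_assoc[symmetric])
    qed
    ultimately have "frag_of (?T z) = frag_of (\<rho> (inv (lift ?t)) (?T x))"
      using cocycle_lift_quotient[OF x c(2)] by simp
    then show ?thesis by (simp add: frag_of_eq)
  qed
  have T_inj: "z = z'" if "?T z = ?T z'" "z \<in> X" "z' \<in> X" for z z'
    using lift_diagonal_bij that by (auto simp: bij_betw_def dest: inj_onD)
  fix y y' assume y: "y \<in> X" "y' \<in> X"
  show "(g_map cocycle_map x y = g_map cocycle_map x y') \<longleftrightarrow> y = y'"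
  proof
    assume e: "g_map cocycle_map x y = g_map cocycle_map x y'"
    have "f_map cocycle_map y x = f_map cocycle_map y' x"
      by (rule T_inj) (use T y e x f_map_cocycle_map_closed in metis)+
    then show "y = y'" using e f_map_g_map_cocycle_map x y by metis
  qed simp
next
  show "g_map cocycle_map x y \<in> X" if "y \<in> X" for y using that x by (rule g_map_cocycle_map_closed[rotated])
  let ?T = "\<lambda>x. \<rho> (lift x) x"
  show "\<exists>y\<in>X. t = g_map cocycle_map x y" if t: "t \<in> X" for t
  proof -
    have "\<rho> (inv (lift t)) (?T x) \<in> ?T ` X"
      using lift_diagonal_bij x t by (simp add: bij_betw_def action_closed)
    then obtain z where z: "z \<in> X" "?T z = \<rho> (inv (lift t)) (?T x)" by force
    define y where "y = f_map cocycle_map z t"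
    have y: "y \<in> X" using z t by (simp add: y_def f_map_cocycle_map_closed)
    have "inv (lift x) \<otimes> lift t = lift y \<otimes> inv (lift z)"
      using x t y z cocycle_lift_quotient[OF x t]
      by (intro cocycle_inj) (simp_all add: cocycle_mult cocycle_inv_lift y_def f_map_cocycle_map action_inv')
    then have "lift t = lift x \<otimes> (lift y \<otimes> inv (lift z))"
      using x t y z by (metis inv_closed inv_solve_left m_closed lift(1))
    then have "lift t \<otimes> lift z = lift x \<otimes> lift y"
      using x y z by (simp add: m_assoc)
    then have "frag_of (f_map cocycle_map y x) + frag_of y = frag_of (f_map cocycle_map z t) + frag_of z"
      using x y z t cocycle_lift_mult by metis
    then have "frag_of (f_map cocycle_map y x) = frag_of z" by (simp add: y_def)
    then have "f_map cocycle_map y x = z" by (simp only: frag_of_eq)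
    then have "g_map cocycle_map x y = t"
      using g_map_cocycle_map_unique[OF x y t] by (simp add: y_def)
    then show ?thesis using y by auto
  qed
qed

lemma f_map_cocycle_map_braid:
  assumes "x \<in> X" "y \<in> X" "u \<in> X"
  shows "f_map cocycle_map (f_map cocycle_map y x) (f_map cocycle_map (g_map cocycle_map x y) u)
       = f_map cocycle_map y (f_map cocycle_map x u)"
proof -
  have *: "f_map cocycle_map b (f_map cocycle_map a u) = \<rho> (inv (lift a \<otimes> lift b)) u"
    if "a \<in> X" "b \<in> X" for a b
    using that assms by (simp add: f_map_cocycle_map inv_mult_group action_mult)
  show ?thesis
    using assms f_map_cocycle_map_closed g_map_cocycle_map_closed lift_relation[of x y]
    by (simp add: *)
qed

text \<open>
  The injective map \<open>J(x, y, z) = (f\<^sub>z f\<^sub>y x, f\<^sub>z y, z)\<close> turns \<open>S\<^sup>1\<^sup>2\<close> and \<open>S\<^sup>2\<^sup>3\<close> into the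
  transpositions of adjacent coordinates, which satisfy the braid relation.
\<close>

lemma braided_cocycle_map: "braided X cocycle_map"
proof -
  define J where "J = (\<lambda>(x, y, z). (f_map cocycle_map z (f_map cocycle_map y x), f_map cocycle_map z y, z))"
  define s12 where "s12 = (\<lambda>(x :: 'a, y :: 'a, z :: 'a). (y, x, z))"
  define s23 where "s23 = (\<lambda>(x :: 'a, y :: 'a, z :: 'a). (x, z, y))"
  have f_inj: "x = x'" if "f_map cocycle_map y x = f_map cocycle_map y x'" "y \<in> X" "x \<in> X" "x' \<in> X"
    for x x' y
    using f_map_cocycle_map_bij[OF that(2)] that by (auto simp: bij_betw_def dest: inj_onD)
  have J_inj: "inj_on J (X \<times> X \<times> X)"
    by (rule inj_onI) (use f_map_cocycle_map_closed in \<open>auto simp: J_def dest!: f_inj\<close>)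
  have cl: "S12 cocycle_map p \<in> X \<times> X \<times> X" "S23 cocycle_map p \<in> X \<times> X \<times> X"
    if "p \<in> X \<times> X \<times> X" for p
    using that f_map_cocycle_map_closed g_map_cocycle_map_closed
    by (auto simp: S12_def S23_def cocycle_map_apply)
  have J12: "J (S12 cocycle_map p) = s12 (J p)" if "p \<in> X \<times> X \<times> X" for p
    using that f_map_g_map_cocycle_map
    by (auto simp: J_def s12_def S12_def cocycle_map_apply)
  have J23: "J (S23 cocycle_map p) = s23 (J p)" if "p \<in> X \<times> X \<times> X" for p
    using that f_map_g_map_cocycle_map f_map_cocycle_map_braid
    by (auto simp: J_def s23_def S23_def cocycle_map_apply)
  show ?thesis
    unfolding braided_def
  proof
    fix p assume p: "p \<in> X \<times> X \<times> X"
    have "s12 (s23 (s12 q)) = s23 (s12 (s23 q))" for q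
      by (simp add: s12_def s23_def case_prod_beta)
    then have "J (S12 cocycle_map (S23 cocycle_map (S12 cocycle_map p)))
        = J (S23 cocycle_map (S12 cocycle_map (S23 cocycle_map p)))"
      using p cl by (simp add: J12 J23)
    then show "S12 cocycle_map (S23 cocycle_map (S12 cocycle_map p))
        = S23 cocycle_map (S12 cocycle_map (S23 cocycle_map p))"
      by (rule inj_onD[OF J_inj]) (use p cl in auto)
  qed
qed

lemma symmetric_set_cocycle_map: "symmetric_set X cocycle_map"
proof
  have "cocycle_map p \<in> X \<times> X" if "p \<in> X \<times> X" for p
    using that f_map_cocycle_map_closed g_map_cocycle_map_closed
    by (auto simp: cocycle_map_apply)
  then have "cocycle_map ` (X \<times> X) \<subseteq> X \<times> X" by blast
  then have "bij_betw cocycle_map (X \<times> X) (X \<times> X)"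
    using involutive_cocycle_map unfolding involutive_def
    by (intro bij_betw_byWitness[where f' = cocycle_map])
  then show "(X, cocycle_map) \<in> nondegenerate_symmetric_sets"
    using nonempty involutive_cocycle_map braided_cocycle_map f_map_cocycle_map_bij
      g_map_cocycle_map_bij
    by (simp add: nondegenerate_symmetric_sets_def nondegenerate_def symmetric_def)
qed

lemma f_inv_cocycle_map:
  assumes "x \<in> X" "y \<in> X" shows "f_inv X cocycle_map x y = \<rho> (lift x) y"
  using f_inv_f[OF symmetric_set.nss[OF symmetric_set_cocycle_map], of x "\<rho> (lift x) y"] assms
  by (simp add: f_map_cocycle_map action_inv action_closed)

end


section \<open>Isomorphisms of symmetric sets and of quadruples\<close>

text \<open>
  The group isomorphism is the extension of \<open>x \<mapsto> \<iota>(f x)\<close>. Products of two generators have symmetric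
  cocycle values, so injectivity of the target cocycle \<open>p\<close> makes it respect the relations.
  It intertwines the cocycles, and since both of them are bijective, so is the homomorphism.
\<close>

lemma (in symmetric_set) quadruple_isomorphic_if:
  fixes H :: "'h monoid"
  assumes H: "bijective_cocycle H Y \<sigma> p" and f: "bij_betw f X Y"
    and f_eq: "\<And>x y. x \<in> X \<Longrightarrow> y \<in> X \<Longrightarrow> f (f_act x y) = \<sigma> (basis_lift H p (f x)) (f y)"
  shows "quadruple_isomorphic (cocycle_quadruple (X, S)) (H, Y, \<sigma>, p)"
proof -
  interpret H: bijective_cocycle H Y \<sigma> p by (fact H)
  define h where "h = (\<lambda>x. H.lift (f x))"
  define \<phi> where "\<phi> = extend_hom H h"
  have fY: "f x \<in> Y" if "x \<in> X" for x using f that by (rule bij_betw_apply)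
  have h: "h x \<in> carrier H" if "x \<in> X" for x using that fY by (simp add: h_def)
  have pair: "p (h x \<otimes>\<^bsub>H\<^esub> h y) = frag_of (f (f_map S y x)) + frag_of (f y)"
    if "x \<in> X" "y \<in> X" for x y
  proof -
    have z: "f_map S y x \<in> X" using that nss_f_closed[OF nss] by simp
    have "f x = \<sigma> (h y) (f (f_map S y x))"
      using f_eq[OF that(2) z] that f_inv_f[OF nss] by (simp add: h_def)
    then have "\<sigma> (inv\<^bsub>H\<^esub> (h y)) (f x) = f (f_map S y x)"
      using H.action_inv h fY that z by simp
    then show ?thesis
      using H.cocycle_mult_frag_of[of "h x" "h y" "f x"] that h fY by (simp add: h_def)
  qed
  have rel: "eval_word H h u = eval_word H h v" if uv: "(u, v) \<in> structure_relations X S" for u v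
  proof -
    obtain x y t z where xyz: "x \<in> X" "y \<in> X" "S (x, y) = (t, z)"
      "u = [(x, True), (y, True)]" "v = [(t, True), (z, True)]"
      using uv by (auto simp: structure_relations_def)
    then have xy: "x \<in> X" "y \<in> X" "u = [(x, True), (y, True)]"
      "v = [(g_map S x y, True), (f_map S y x, True)]"
      by (simp_all add: g_map_def f_map_def)
    have tz: "g_map S x y \<in> X" "f_map S y x \<in> X"
      using xy nss_g_closed[OF nss] nss_f_closed[OF nss] by auto
    have "h x \<otimes>\<^bsub>H\<^esub> h y = h (g_map S x y) \<otimes>\<^bsub>H\<^esub> h (f_map S y x)"
      using xy tz h pair nss_invol[OF nss xy(1,2)] by (intro H.cocycle_inj) (simp_all add: add.commute)
    then show ?thesis using xy tz h by simp
  qed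
  have \<phi>_hom: "\<phi> \<in> hom G H"
    unfolding \<phi>_def structure_group_def by (rule extend_hom_hom) (use h rel H.is_group in auto)
  interpret \<phi>: group_hom G H \<phi>
    using \<phi>_hom by unfold_locales
  have \<phi>_gen: "\<phi> (gen x) = h x" if "x \<in> X" for x
    unfolding \<phi>_def gen_def by (rule extend_hom_generator[where X = X]) (use h rel H.is_group that in auto)
  have act: "\<forall>y\<in>X. \<sigma> (\<phi> a) (f y) = f (\<rho> a y)" if "a \<in> carrier G" for a
    using that
  proof (induction rule: structure_group_induct)
    case one
    then show ?case using fY by (simp add: H.action_one coc.action_one)
  next
    case (step x b)
    have "\<sigma> (\<phi> (gen x \<otimes>\<^bsub>G\<^esub> b)) (f y) = f (\<rho> (gen x \<otimes>\<^bsub>G\<^esub> b) y) \<longleftrightarrow> \<sigma> (\<phi> b) (f y) = f (\<rho> b y)"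
      if y: "y \<in> X" for y
    proof -
      have c: "\<sigma> (\<phi> b) (f y) \<in> Y" "f (\<rho> b y) \<in> Y" "\<rho> b y \<in> X"
        using step y fY H.action_closed coc.action_closed by auto
      have "\<sigma> (\<phi> (gen x \<otimes>\<^bsub>G\<^esub> b)) (f y) = \<sigma> (h x) (\<sigma> (\<phi> b) (f y))"
        using step y fY h by (simp add: H.action_mult \<phi>_gen)
      moreover have "f (\<rho> (gen x \<otimes>\<^bsub>G\<^esub> b) y) = \<sigma> (h x) (f (\<rho> b y))"
        using step y c f_eq by (simp add: coc.action_mult action_gen h_def)
      ultimately show ?thesis
        using H.action_inv[OF h[OF step(1)]] c by metis
    qed
    then show ?case by simp
  qed
  have coc_eq: "p (\<phi> a) = frag_map f (\<pi> a)" if "a \<in> carrier G" for a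
    using that
  proof (induction rule: structure_group_induct)
    case one
    then show ?case by (simp add: H.cocycle_one coc.cocycle_one)
  next
    case (step x b)
    have "\<sigma> (inv\<^bsub>H\<^esub> (\<phi> b)) (f x) = f (\<rho> (inv\<^bsub>G\<^esub> b) x)"
      using act[of "inv\<^bsub>G\<^esub> b"] step by simp
    then have "p (\<phi> (gen x \<otimes>\<^bsub>G\<^esub> b)) = frag_of (f (\<rho> (inv\<^bsub>G\<^esub> b) x)) + p (\<phi> b)"
      using H.cocycle_mult_frag_of[of "h x" "\<phi> b" "f x"] step h fY by (simp add: \<phi>_gen h_def)
    moreover have "frag_map f (\<pi> (gen x \<otimes>\<^bsub>G\<^esub> b)) = frag_of (f (\<rho> (inv\<^bsub>G\<^esub> b) x)) + frag_map f (\<pi> b)"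
      using coc.cocycle_mult_frag_of[of "gen x" b x] step by (simp add: cocycle_gen frag_map_add)
    ultimately show ?case by simp
  qed
  have "bij_betw (frag_map f \<circ> \<pi>) (carrier G) (carrier (free_Abelian_group Y))"
    by (rule bij_betw_trans[OF coc.cocycle_bij bij_betw_frag_map[OF f]])
  then have "bij_betw (p \<circ> \<phi>) (carrier G) (carrier (free_Abelian_group Y))"
    by (rule bij_betw_cong[THEN iffD1, rotated]) (simp add: coc_eq)
  then have "bij_betw \<phi> (carrier G) (carrier H)"
    using bij_betw_comp_iff2[OF H.cocycle_bij, of \<phi> "carrier G"] \<phi>.hom_closed by blast
  then have "\<phi> \<in> iso G H" using \<phi>_hom by (simp add: iso_def)
  then show ?thesis
    using f act coc_eq unfolding quadruple_isomorphic_def cocycle_quadruple_def prod.case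
    by (intro exI[of _ f] exI[of _ \<phi>]) simp
qed

text \<open>
  Conversely, compatibility with the cocycles forces the group isomorphism to send the generator \<open>x\<close>
  to \<open>\<iota>(f x)\<close>, so compatibility with the actions, applied to that generator,
  is the displayed equation.
\<close>

lemma (in symmetric_set) quadruple_isomorphic_iff:
  fixes H :: "'h monoid"
  assumes H: "bijective_cocycle H Y \<sigma> p"
  shows "quadruple_isomorphic (cocycle_quadruple (X, S)) (H, Y, \<sigma>, p) \<longleftrightarrow>
    (\<exists>f. bij_betw f X Y \<and> (\<forall>x\<in>X. \<forall>y\<in>X. f (f_act x y) = \<sigma> (basis_lift H p (f x)) (f y)))"
proof
  interpret H: bijective_cocycle H Y \<sigma> p by (fact H)
  assume "quadruple_isomorphic (cocycle_quadruple (X, S)) (H, Y, \<sigma>, p)"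
  then obtain f \<phi> where f: "bij_betw f X Y" and \<phi>: "\<phi> \<in> iso G H"
    and act: "\<And>a x. a \<in> carrier G \<Longrightarrow> x \<in> X \<Longrightarrow> \<sigma> (\<phi> a) (f x) = f (\<rho> a x)"
    and coc: "\<And>a. a \<in> carrier G \<Longrightarrow> p (\<phi> a) = frag_map f (\<pi> a)"
    by (auto simp: quadruple_isomorphic_def cocycle_quadruple_def)
  have "f (f_act x y) = \<sigma> (H.lift (f x)) (f y)" if "x \<in> X" "y \<in> X" for x y
  proof -
    have "\<phi> (gen x) = H.lift (f x)"
      using that \<phi> bij_betw_apply[OF f] coc[of "gen x"]
      by (intro H.lift_unique) (auto simp: cocycle_gen iso_def hom_def)
    then show ?thesis using act[of "gen x" y] that by (simp add: action_gen)
  qed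
  then show "\<exists>f. bij_betw f X Y \<and> (\<forall>x\<in>X. \<forall>y\<in>X. f (f_act x y) = \<sigma> (H.lift (f x)) (f y))"
    using f by blast
qed (use quadruple_isomorphic_if[OF H] in blast)

text \<open>
  The maps \<open>f\<^sub>x\<close> determine \<open>S\<close>, because \<open>g\<^sub>x(y) = f\<^sub>z\<^sup>-\<^sup>1(y)\<close> for \<open>z = f\<^sub>y(x)\<close>.
\<close>

lemma set_isomorphic_iff_f_inv:
  assumes P: "(X, S) \<in> nondegenerate_symmetric_sets" and P': "(X', S') \<in> nondegenerate_symmetric_sets"
  shows "set_isomorphic (X, S) (X', S') \<longleftrightarrow>
    (\<exists>f. bij_betw f X X' \<and> (\<forall>x\<in>X. \<forall>y\<in>X. f (f_inv X S x y) = f_inv X' S' (f x) (f y)))"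
proof -
  interpret P: symmetric_set X S by standard (fact P)
  interpret P': symmetric_set X' S' by standard (fact P')
  have "(\<forall>x\<in>X. \<forall>y\<in>X. S' (f x, f y) = map_prod f f (S (x, y))) \<longleftrightarrow>
        (\<forall>x\<in>X. \<forall>y\<in>X. f (f_inv X S x y) = f_inv X' S' (f x) (f y))" (is "?L \<longleftrightarrow> ?R")
    if f: "bij_betw f X X'" for f
  proof -
    have fX: "f x \<in> X'" if "x \<in> X" for x using f that by (rule bij_betw_apply)
    show ?thesis
    proof
      assume L: ?L
      show ?R
      proof (intro ballI)
        fix x y assume xy: "x \<in> X" "y \<in> X"
        let ?u = "f_inv X S x y"
        have u: "?u \<in> X" "f_map S x ?u = y" using xy f_inv_in[OF P] f_f_inv[OF P] by auto
        have "f_map S' (f x) (f ?u) = f y" using L u xy by (simp add: f_map_def)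
        then show "f ?u = f_inv X' S' (f x) (f y)"
          using f_inv_f[OF P', of "f x" "f ?u"] xy u fX by simp
      qed
    next
      assume R: ?R
      show ?L
      proof (intro ballI)
        fix x y assume xy: "x \<in> X" "y \<in> X"
        let ?z = "f_map S y x"
        have z: "?z \<in> X" using xy nss_f_closed[OF P] by simp
        have "f x = f_inv X' S' (f y) (f ?z)" using R xy z f_inv_f[OF P, of y x] by metis
        then have f': "f_map S' (f y) (f x) = f ?z" using f_f_inv[OF P'] xy z fX by simp
        then have "g_map S' (f x) (f y) = f_inv X' S' (f ?z) (f y)"
          using P'.g_map_conv xy fX by simp
        also have "\<dots> = f (g_map S x y)" using R P.g_map_conv xy z by simp
        finally show "S' (f x, f y) = map_prod f f (S (x, y))"
          using f' by (simp add: nss_S[OF P] nss_S[OF P'])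
      qed
    qed
  qed
  then show ?thesis unfolding set_isomorphic_def prod.case by blast
qed

lemma cocycle_quadruple_bijective:
  "P \<in> nondegenerate_symmetric_sets \<Longrightarrow> cocycle_quadruple P \<in> bijective_cocycle_quadruples"
proof -
  assume "P \<in> nondegenerate_symmetric_sets"
  moreover obtain X S where P: "P = (X, S)" by fastforce
  ultimately interpret symmetric_set X S by unfold_locales simp
  show ?thesis
    using coc.bijective_cocycle_axioms by (simp add: P cocycle_quadruple_def bijective_cocycle_iff)
qed

lemma set_isomorphic_iff_quadruple_isomorphic:
  assumes "P \<in> nondegenerate_symmetric_sets" "P' \<in> nondegenerate_symmetric_sets"
  shows "set_isomorphic P P' \<longleftrightarrow> quadruple_isomorphic (cocycle_quadruple P) (cocycle_quadruple P')"
proof -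
  obtain X S X' S' where P: "P = (X, S)" "P' = (X', S')" by fastforce
  interpret P: symmetric_set X S using assms P by unfold_locales simp
  interpret P': symmetric_set X' S' using assms P by unfold_locales simp
  have "f_inv X' S' x = P'.\<rho> (basis_lift P'.G P'.\<pi> x)" if "x \<in> X'" for x
    using that by (simp add: P'.lift_eq_gen P'.action_gen)
  moreover have cq: "cocycle_quadruple (X', S') = (P'.G, X', P'.\<rho>, P'.\<pi>)"
    by (simp add: cocycle_quadruple_def)
  ultimately show ?thesis
    unfolding P set_isomorphic_iff_f_inv[OF P.nss P'.nss] cq
      P.quadruple_isomorphic_iff[OF P'.coc.bijective_cocycle_axioms]
    by (metis bij_betw_apply)
qed

text \<open>
  The identity of \<open>X\<close> meets the criterion \<open>quadruple_isomorphic_if\<close> for the reconstructed symmetric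
  set.
\<close>

lemma quadruple_isomorphic_cocycle_quadruple:
  fixes Q :: "('g, 'a) quadruple"
  assumes "Q \<in> bijective_cocycle_quadruples"
  shows "\<exists>P \<in> (nondegenerate_symmetric_sets :: 'a set_with_map set). quadruple_isomorphic (cocycle_quadruple P) Q"
proof -
  obtain G X \<rho> \<pi> where Q: "Q = (G, X, \<rho>, \<pi>)" by (cases Q)
  then interpret bijective_cocycle G X \<rho> \<pi> using assms by (simp add: bijective_cocycle_iff)
  have "quadruple_isomorphic (cocycle_quadruple (X, cocycle_map)) Q"
    unfolding Q
    by (rule symmetric_set.quadruple_isomorphic_if[OF symmetric_set_cocycle_map, where f = "\<lambda>x. x"])
      (use bijective_cocycle_axioms in \<open>simp_all add: f_inv_cocycle_map bij_betw_def\<close>)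
  then show ?thesis using symmetric_set.nss[OF symmetric_set_cocycle_map] by blast
qed

lemma quadruple_isomorphic_refl:
  assumes "Q \<in> bijective_cocycle_quadruples" shows "quadruple_isomorphic Q Q"
proof -
  obtain G X \<rho> \<pi> where Q: "Q = (G, X, \<rho>, \<pi>)" by (cases Q)
  then interpret bijective_cocycle G X \<rho> \<pi> using assms by (simp add: bijective_cocycle_iff)
  have "frag_map (\<lambda>x. x) (\<pi> a) = \<pi> a" if "a \<in> carrier G" for a
    by (rule frag_map_id[OF cocycle_closed[OF that]]) simp
  moreover have "(\<lambda>a. a) \<in> iso G G" by (simp add: iso_def hom_def bij_betw_def)
  moreover have "bij_betw (\<lambda>x. x) X X" by (simp add: bij_betw_def)
  ultimately show ?thesis
    unfolding Q quadruple_isomorphic_def prod.case by (intro exI[of _ "\<lambda>x. x"]) simp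
qed

lemma quadruple_isomorphic_sym:
  assumes Q\<^sub>1: "Q\<^sub>1 \<in> bijective_cocycle_quadruples"
    and iso: "quadruple_isomorphic Q\<^sub>1 Q\<^sub>2"
  shows "quadruple_isomorphic Q\<^sub>2 Q\<^sub>1"
proof -
  obtain G X \<rho> \<pi> where Q: "Q\<^sub>1 = (G, X, \<rho>, \<pi>)" by (cases Q\<^sub>1)
  obtain H Y \<sigma> p where Q': "Q\<^sub>2 = (H, Y, \<sigma>, p)" by (cases Q\<^sub>2)
  interpret bijective_cocycle G X \<rho> \<pi> using Q Q\<^sub>1 by (simp add: bijective_cocycle_iff)
  obtain f \<phi> where f: "bij_betw f X Y" and \<phi>: "\<phi> \<in> iso G H"
    and act: "\<And>a x. a \<in> carrier G \<Longrightarrow> x \<in> X \<Longrightarrow> \<sigma> (\<phi> a) (f x) = f (\<rho> a x)"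
    and coc: "\<And>a. a \<in> carrier G \<Longrightarrow> p (\<phi> a) = frag_map f (\<pi> a)"
    using iso unfolding Q Q' by (auto simp: quadruple_isomorphic_def)
  let ?f = "inv_into X f" and ?\<phi> = "inv_into (carrier G) \<phi>"
  have \<phi>_bij: "bij_betw \<phi> (carrier G) (carrier H)" using \<phi> by (simp add: iso_def)
  have "\<rho> (?\<phi> b) (?f y) = ?f (\<sigma> b y) \<and> \<pi> (?\<phi> b) = frag_map ?f (p b)"
    if b: "b \<in> carrier H" and y: "y \<in> Y" for b y
  proof -
    define a where "a = ?\<phi> b"
    define x where "x = ?f y"
    have a: "a \<in> carrier G" "b = \<phi> a"
      using b \<phi>_bij bij_betw_apply[OF bij_betw_inv_into[OF \<phi>_bij]]
      by (simp_all add: a_def bij_betw_inv_into_right)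
    have x: "x \<in> X" "y = f x"
      using y f bij_betw_apply[OF bij_betw_inv_into[OF f]]
      by (simp_all add: x_def bij_betw_inv_into_right)
    have "?f (\<sigma> b y) = \<rho> a x"
      using a x f act[of a x] by (simp add: bij_betw_inv_into_left action_closed)
    moreover have "frag_map ?f (p b) = \<pi> a"
      using a coc[of a] bij_betw_inv_into_left[OF f]
      by (auto simp: frag_map_frag_map intro!: frag_map_id[OF cocycle_closed])
    ultimately show ?thesis by (simp add: a_def x_def)
  qed
  moreover have "Y \<noteq> {}" using f nonempty by (auto simp: bij_betw_def)
  moreover have "?\<phi> \<in> iso H G" using iso_set_sym[OF \<phi>] .
  moreover have "bij_betw ?f Y X" using bij_betw_inv_into[OF f] .
  ultimately show ?thesis
    unfolding Q Q' quadruple_isomorphic_def prod.case by (intro exI[of _ ?f] exI[of _ ?\<phi>]) blast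
qed

lemma quadruple_isomorphic_trans:
  assumes "quadruple_isomorphic Q\<^sub>1 Q\<^sub>2" "quadruple_isomorphic Q\<^sub>2 Q\<^sub>3"
  shows "quadruple_isomorphic Q\<^sub>1 Q\<^sub>3"
proof -
  obtain G X \<rho> \<pi> where Q1: "Q\<^sub>1 = (G, X, \<rho>, \<pi>)" by (cases Q\<^sub>1)
  obtain H Y \<sigma> p where Q2: "Q\<^sub>2 = (H, Y, \<sigma>, p)" by (cases Q\<^sub>2)
  obtain K Z \<tau> q where Q3: "Q\<^sub>3 = (K, Z, \<tau>, q)" by (cases Q\<^sub>3)
  obtain f \<phi> where f: "bij_betw f X Y" "\<phi> \<in> iso G H"
    "\<And>a x. a \<in> carrier G \<Longrightarrow> x \<in> X \<Longrightarrow> \<sigma> (\<phi> a) (f x) = f (\<rho> a x)"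
    "\<And>a. a \<in> carrier G \<Longrightarrow> p (\<phi> a) = frag_map f (\<pi> a)"
    using assms(1) unfolding Q1 Q2 by (auto simp: quadruple_isomorphic_def)
  obtain g \<psi> where g: "bij_betw g Y Z" "\<psi> \<in> iso H K"
    "\<And>a x. a \<in> carrier H \<Longrightarrow> x \<in> Y \<Longrightarrow> \<tau> (\<psi> a) (g x) = g (\<sigma> a x)"
    "\<And>a. a \<in> carrier H \<Longrightarrow> q (\<psi> a) = frag_map g (p a)"
    using assms(2) unfolding Q2 Q3 by (auto simp: quadruple_isomorphic_def)
  have "\<phi> a \<in> carrier H" if "a \<in> carrier G" for a using f(2) that by (auto simp: iso_def hom_def)
  moreover have "f x \<in> Y" if "x \<in> X" for x using bij_betw_apply[OF f(1) that] .
  moreover have "bij_betw (g \<circ> f) X Z" using bij_betw_trans[OF f(1) g(1)] .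
  moreover have "\<psi> \<circ> \<phi> \<in> iso G K" using iso_set_trans[OF f(2) g(2)] .
  ultimately show ?thesis
    unfolding Q1 Q3 quadruple_isomorphic_def prod.case
    by (intro exI[of _ "g \<circ> f"] exI[of _ "\<psi> \<circ> \<phi>"]) (simp add: f g frag_map_frag_map)
qed

lemma equiv_quadruple_iso_rel: "equiv bijective_cocycle_quadruples quadruple_iso_rel"
proof (rule equivI)
  show "quadruple_iso_rel \<subseteq> bijective_cocycle_quadruples \<times> bijective_cocycle_quadruples"
    by (auto simp: quadruple_iso_rel_def)
  show "refl_on bijective_cocycle_quadruples quadruple_iso_rel"
    using quadruple_isomorphic_refl by (fastforce simp: refl_on_def quadruple_iso_rel_def)
  show "sym quadruple_iso_rel"
    using quadruple_isomorphic_sym by (fastforce simp: sym_def quadruple_iso_rel_def)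
  show "trans quadruple_iso_rel"
    using quadruple_isomorphic_trans unfolding trans_def quadruple_iso_rel_def by fast
qed

lemma set_iso_rel_iff:
  "P \<in> nondegenerate_symmetric_sets \<Longrightarrow> P' \<in> nondegenerate_symmetric_sets \<Longrightarrow>
     (P, P') \<in> set_iso_rel \<longleftrightarrow> (cocycle_quadruple P, cocycle_quadruple P') \<in> quadruple_iso_rel"
  by (simp add: set_iso_rel_def quadruple_iso_rel_def cocycle_quadruple_bijective
      set_isomorphic_iff_quadruple_isomorphic)

text \<open>
  With \<open>A\<close> the symmetric sets and \<open>F\<close> the map to quadruples, this makes isomorphism of symmetric sets
  an equivalence relation because isomorphism of quadruples is one.
\<close>

lemma equiv_pullback:
  assumes q: "equiv B q" and F: "F ` A \<subseteq> B" and r: "r \<subseteq> A \<times> A"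
    and iff: "\<And>x y. x \<in> A \<Longrightarrow> y \<in> A \<Longrightarrow> (x, y) \<in> r \<longleftrightarrow> (F x, F y) \<in> q"
  shows "equiv A r"
proof (rule equivI)
  have q': "refl_on B q" "sym q" "trans q" using q by (auto elim: equivE)
  show "refl_on A r" using q'(1) F iff by (auto simp: refl_on_def)
  have mem: "x \<in> A" "y \<in> A" if "(x, y) \<in> r" for x y using that r by auto
  show "sym r" by (rule symI) (use mem iff symD[OF q'(2)] in metis)
  show "trans r" by (rule transI) (use mem iff transD[OF q'(3)] in metis)
qed (fact r)

lemma bij_betw_quotient:
  assumes q: "equiv B q" and F: "F ` A \<subseteq> B" and r: "r \<subseteq> A \<times> A"
    and iff: "\<And>x y. x \<in> A \<Longrightarrow> y \<in> A \<Longrightarrow> (x, y) \<in> r \<longleftrightarrow> (F x, F y) \<in> q"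
    and ess_surj: "\<And>b. b \<in> B \<Longrightarrow> \<exists>x\<in>A. (F x, b) \<in> q"
  shows "bij_betw (\<lambda>C. q `` (F ` C)) (A // r) (B // q)"
proof -
  have equiv_r: "equiv A r" by (rule equiv_pullback[OF q F r iff])
  have class_image: "q `` (F ` (r `` {x})) = q `` {F x}" if x: "x \<in> A" for x
  proof -
    have "q `` {F y} = q `` {F x}" if "y \<in> r `` {x}" for y
      using that x r iff equiv_class_eq[OF q, of "F x" "F y"] by blast
    moreover have "x \<in> r `` {x}" using equiv_class_self[OF equiv_r x] .
    moreover have "q `` (F ` (r `` {x})) = (\<Union>y\<in>r `` {x}. q `` {F y})" by blast
    ultimately show ?thesis by blast
  qed
  show ?thesis
  proof (rule bij_betw_imageI)
    show "inj_on (\<lambda>C. q `` (F ` C)) (A // r)"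
    proof (rule inj_onI)
      fix C D assume "C \<in> A // r" "D \<in> A // r" and e: "q `` (F ` C) = q `` (F ` D)"
      then obtain x y where xy: "x \<in> A" "y \<in> A" "C = r `` {x}" "D = r `` {y}"
        by (auto elim!: quotientE)
      then have "q `` {F x} = q `` {F y}" using e class_image by simp
      then have "(F x, F y) \<in> q" using eq_equiv_class[OF _ q] xy F by blast
      then show "C = D" using xy iff equiv_class_eq[OF equiv_r] by blast
    qed
    show "(\<lambda>C. q `` (F ` C)) ` (A // r) = B // q"
    proof
      show "(\<lambda>C. q `` (F ` C)) ` (A // r) \<subseteq> B // q"
        using F class_image by (auto elim!: quotientE intro!: quotientI)
      show "B // q \<subseteq> (\<lambda>C. q `` (F ` C)) ` (A // r)"
      proof
        fix D assume "D \<in> B // q"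
        then obtain b where b: "b \<in> B" "D = q `` {b}" by (auto elim!: quotientE)
        obtain x where x: "x \<in> A" "(F x, b) \<in> q" using ess_surj[OF b(1)] by blast
        have "D = q `` (F ` (r `` {x}))" using b x class_image equiv_class_eq[OF q x(2)] by simp
        then show "D \<in> (\<lambda>C. q `` (F ` C)) ` (A // r)" using quotientI[OF x(1)] by blast
      qed
    qed
  qed
qed

theorem theorem2p9:
  shows
    "(\<forall>P \<in> (nondegenerate_symmetric_sets :: 'a set_with_map set).
        cocycle_quadruple P \<in> bijective_cocycle_quadruples) \<and>
     (\<forall>P \<in> (nondegenerate_symmetric_sets :: 'a set_with_map set).
      \<forall>P' \<in> (nondegenerate_symmetric_sets :: 'b set_with_map set).
        set_isomorphic P P' \<longleftrightarrow>
        quadruple_isomorphic (cocycle_quadruple P) (cocycle_quadruple P')) \<and>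
     (\<forall>Q \<in> (bijective_cocycle_quadruples :: ('g, 'a) quadruple set).
      \<exists>P \<in> (nondegenerate_symmetric_sets :: 'a set_with_map set).
        quadruple_isomorphic (cocycle_quadruple P) Q) \<and>
     bij_betw (\<lambda>C. quadruple_iso_rel `` (cocycle_quadruple ` C))
       ((nondegenerate_symmetric_sets :: 'a set_with_map set) // set_iso_rel)
       (bijective_cocycle_quadruples // quadruple_iso_rel)"
proof (intro conjI ballI)
  show "cocycle_quadruple P \<in> bijective_cocycle_quadruples"
    if "P \<in> nondegenerate_symmetric_sets" for P :: "'a set_with_map"
    using that by (rule cocycle_quadruple_bijective)
  show "set_isomorphic P P' \<longleftrightarrow> quadruple_isomorphic (cocycle_quadruple P) (cocycle_quadruple P')"
    if "P \<in> nondegenerate_symmetric_sets" "P' \<in> nondegenerate_symmetric_sets"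
    for P :: "'a set_with_map" and P' :: "'b set_with_map"
    using that by (rule set_isomorphic_iff_quadruple_isomorphic)
  show "\<exists>P \<in> (nondegenerate_symmetric_sets :: 'a set_with_map set).
      quadruple_isomorphic (cocycle_quadruple P) Q"
    if "Q \<in> bijective_cocycle_quadruples" for Q :: "('g, 'a) quadruple"
    using that by (rule quadruple_isomorphic_cocycle_quadruple)
  show "bij_betw (\<lambda>C. quadruple_iso_rel `` (cocycle_quadruple ` C))
       ((nondegenerate_symmetric_sets :: 'a set_with_map set) // set_iso_rel)
       (bijective_cocycle_quadruples // quadruple_iso_rel)"
  proof (rule bij_betw_quotient[OF equiv_quadruple_iso_rel _ _ set_iso_rel_iff])
    show "cocycle_quadruple ` nondegenerate_symmetric_sets \<subseteq> bijective_cocycle_quadruples"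
      using cocycle_quadruple_bijective by blast
    show "set_iso_rel \<subseteq> nondegenerate_symmetric_sets \<times> nondegenerate_symmetric_sets"
      by (auto simp: set_iso_rel_def)
    show "\<exists>P\<in>nondegenerate_symmetric_sets. (cocycle_quadruple P, Q) \<in> quadruple_iso_rel"
      if Q: "Q \<in> bijective_cocycle_quadruples" for Q :: "('a group_word set, 'a) quadruple"
      using quadruple_isomorphic_cocycle_quadruple[OF Q] Q
      by (auto simp: quadruple_iso_rel_def cocycle_quadruple_bijective)
  qed
qed

end
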